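(* Consider the $(n+1)$-degree-of-freedom Hamiltonian system $$\dot q_i=\frac{\partial\tilde H^\varepsilon}{\partial p_i},\quad \dot p_i=-\frac{\partial\tilde H^\varepsilon}{\partial q_i},\quad i=1,\dots,n,\qquad \dot q_0=\frac{\partial\tilde H^\varepsilon}{\partial p_0},\quad \dot p_0=-\frac{\partial\tilde H^\varepsilon}{\partial q_0},$$ where $q=(q_1,\dots,q_n)$, $p=(p_1,\dots,p_n)$, the smooth Hamiltonian satisfies $\tilde H^\varepsilon(q,p,q_0)=O(|(\varepsilon,q_0,q,p)|\,|(q_0,q,p)|)$, and $p_0$ is cyclic (that is, $\tilde H^\varepsilon$ does not depend upon $p_0$, so that $q_0$ is conserved). There exists a near-identity canonical change of variables $(q,p,q_0,p_0)\mapsto(Q,P,Q_0,P_0)$ with the properties that $P_0$ is cyclic for the transformed Hamiltonian, $Q_0=q_0$, and the lower-order Hamiltonian system $$\dot Q_i=\frac{\partial\tilde H^\varepsilon}{\partial P_i}(Q,P,0),\qquad \dot P_i=-\frac{\partial\tilde H^\varepsilon}{\partial Q_i}(Q,P,0),\qquad i=1,\dots,n,$$ where the transformed Hamiltonian is again denoted by $\tilde H^\varepsilon(Q,P,Q_0)$, adopts its usual (Elphick) normal form.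
   Context: All statements are local near the origin, and $\varepsilon$ is a (finite-dimensional real) parameter near $0$. A near-identity change of variables depends smoothly on the variables and on $\varepsilon$ and, at $\varepsilon=0$, fixes the origin and has the identity as its derivative there. Canonical means that it preserves the symplectic form $\sum_{i=0}^n\mathrm{d}q_i\wedge\mathrm{d}p_i$ for each $\varepsilon$. Usual (Elphick) normal form: let $x=(Q,P)$, let $H_2(x)$ be the part of $\tilde H^0(Q,P,0)$ (that is, with $\varepsilon=0$) which is homogeneous of degree $2$ in $x$, and let $A$ be the matrix of the linear Hamiltonian vector field of $H_2$, so that $\dot x=Ax$ are Hamilton's equations for $H_2$. For a prescribed order $n_0\ge2$, the system with Hamiltonian $\tilde H^\varepsilon(Q,P,0)$ is in its usual normal form (to order $n_0+1$) if $\tilde H^\varepsilon(Q,P,0)=H_2(x)+N(x,\varepsilon)+R(x,\varepsilon)$, where $N$ is a polynomial of degree at most $n_0+1$ in $(x,\varepsilon)$ with $N(\mathrm{e}^{tA^{\mathrm T}}x,\varepsilon)=N(x,\varepsilon)$ for all $t\in\mathbb{R}$, and $R$ is a remainder of order at least $n_0+2$ in $(x,\varepsilon)$. *)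

theory Defs
  imports "HOL-Analysis.Analysis" "HOL-Library.Landau_Symbols"
begin

text \<open>Only meant for open sets \<open>S\<close>.\<close>

primrec Ck_on :: "nat \<Rightarrow> 'a::real_normed_vector set \<Rightarrow> ('a \<Rightarrow> 'b::real_normed_vector) \<Rightarrow> bool" where
  "Ck_on 0 S f \<longleftrightarrow> continuous_on S f"
| "Ck_on (Suc k) S f \<longleftrightarrow>
     (\<forall>x\<in>S. f differentiable (at x)) \<and>
     (\<forall>v. Ck_on k S (\<lambda>x. frechet_derivative f (at x) v))"

definition smooth_on :: "'a::real_normed_vector set \<Rightarrow> ('a \<Rightarrow> 'b::real_normed_vector) \<Rightarrow> bool" where
  "smooth_on S f \<longleftrightarrow> (\<forall>k. Ck_on k S f)"

definition polynomial_degree_le :: "nat \<Rightarrow> ('a::euclidean_space \<Rightarrow> real) \<Rightarrow> bool" where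
  "polynomial_degree_le d f \<longleftrightarrow>
     (\<exists>c. \<forall>z. f z = (\<Sum>\<alpha> | \<alpha> \<in> Basis \<rightarrow>\<^sub>E {..d} \<and> (\<Sum>b\<in>Basis. \<alpha> b) \<le> d.
                         c \<alpha> * (\<Prod>b\<in>Basis. (z \<bullet> b) ^ \<alpha> b)))"

definition partial_derivative :: "'k::finite \<Rightarrow> (real ^ 'k \<Rightarrow> real) \<Rightarrow> real ^ 'k \<Rightarrow> real" where
  "partial_derivative k f x = frechet_derivative f (at x) (axis k 1)"

text \<open>The homogeneous part of degree 2 of the Taylor expansion at the origin.\<close>

definition quadratic_part :: "(real ^ 'k::finite \<Rightarrow> real) \<Rightarrow> real ^ 'k \<Rightarrow> real" where
  "quadratic_part f x =
     1 / 2 * (\<Sum>j\<in>UNIV. \<Sum>k\<in>UNIV.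
       partial_derivative j (partial_derivative k f) 0 * x $ j * x $ k)"

definition mat_exp :: "real ^ 'k ^ 'k::finite \<Rightarrow> real ^ 'k ^ 'k" where
  "mat_exp M = (\<Sum>j. (1 / fact j) *\<^sub>R (((**) M ^^ j) (mat 1)))"

text \<open>
  A point \<open>x = (q, p)\<close> with \<open>q = (q\<^sub>1, \<dots>, q\<^sub>n)\<close> and \<open>p = (p\<^sub>1, \<dots>, p\<^sub>n)\<close> is a vector of
  type \<^typ>\<open>real ^ ('n + 'n)\<close>, with \<open>q\<^sub>i = x $ Inl i\<close> and \<open>p\<^sub>i = x $ Inr i\<close>.
  A point of the phase space with \<open>n + 1\<close> degrees of freedom is a triple \<open>(x, q\<^sub>0, p\<^sub>0)\<close>.
\<close>

type_synonym 'n phase = "(real ^ ('n + 'n)) \<times> real \<times> real"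

text \<open>\<open>\<Sum>\<^sub>i dq\<^sub>i \<and> dp\<^sub>i\<close>, the sum being over \<open>i = 0, \<dots>, n\<close>.\<close>

fun symplectic_form :: "'n::finite phase \<Rightarrow> 'n phase \<Rightarrow> real" where
  "symplectic_form (x, q\<^sub>0, p\<^sub>0) (x', q\<^sub>0', p\<^sub>0') =
     (q\<^sub>0 * p\<^sub>0' - p\<^sub>0 * q\<^sub>0') + (\<Sum>i\<in>UNIV. x $ Inl i * x' $ Inr i - x $ Inr i * x' $ Inl i)"

definition hamiltonian_vector_field ::
    "(real ^ ('n::finite + 'n) \<Rightarrow> real) \<Rightarrow> real ^ ('n + 'n) \<Rightarrow> real ^ ('n + 'n)" where
  "hamiltonian_vector_field h x =
     (\<chi> k. case k of Inl i \<Rightarrow> partial_derivative (Inr i) h x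
                   | Inr i \<Rightarrow> - partial_derivative (Inl i) h x)"

text \<open>
  Everything is local: \<open>W\<close> is a neighbourhood of the origin in the product of parameter space
  and phase space.
\<close>

definition p0_cyclic_on ::
    "((real ^ 'm::finite) \<times> 'n::finite phase) set \<Rightarrow> (real ^ 'm \<Rightarrow> 'n phase \<Rightarrow> real) \<Rightarrow> bool" where
  "p0_cyclic_on W H \<longleftrightarrow>
     (\<forall>\<epsilon> x q\<^sub>0 p\<^sub>0 p\<^sub>0'. (\<epsilon>, x, q\<^sub>0, p\<^sub>0) \<in> W \<longrightarrow> (\<epsilon>, x, q\<^sub>0, p\<^sub>0') \<in> W \<longrightarrow>
        H \<epsilon> (x, q\<^sub>0, p\<^sub>0) = H \<epsilon> (x, q\<^sub>0, p\<^sub>0'))"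

text \<open>\<open>\<Phi> \<epsilon>\<close> maps the old variables to the new ones and \<open>\<Psi> \<epsilon>\<close> is its inverse.\<close>

definition change_of_variables ::
    "((real ^ 'm::finite) \<times> 'n::finite phase) set \<Rightarrow> ((real ^ 'm) \<times> 'n phase) set \<Rightarrow>
     (real ^ 'm \<Rightarrow> 'n phase \<Rightarrow> 'n phase) \<Rightarrow> (real ^ 'm \<Rightarrow> 'n phase \<Rightarrow> 'n phase) \<Rightarrow> bool" where
  "change_of_variables U V \<Phi> \<Psi> \<longleftrightarrow>
     open U \<and> open V \<and>
     smooth_on U (\<lambda>(\<epsilon>, z). \<Phi> \<epsilon> z) \<and> smooth_on V (\<lambda>(\<epsilon>, z). \<Psi> \<epsilon> z) \<and>
     (\<forall>(\<epsilon>, z)\<in>U. (\<epsilon>, \<Phi> \<epsilon> z) \<in> V \<and> \<Psi> \<epsilon> (\<Phi> \<epsilon> z) = z) \<and>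
     (\<forall>(\<epsilon>, z)\<in>V. (\<epsilon>, \<Psi> \<epsilon> z) \<in> U \<and> \<Phi> \<epsilon> (\<Psi> \<epsilon> z) = z)"

definition near_identity :: "(real ^ 'm::finite \<Rightarrow> 'n::finite phase \<Rightarrow> 'n phase) \<Rightarrow> bool" where
  "near_identity \<Phi> \<longleftrightarrow> \<Phi> 0 0 = 0 \<and> (\<Phi> 0 has_derivative (\<lambda>v. v)) (at 0)"

definition canonical_on ::
    "((real ^ 'm::finite) \<times> 'n::finite phase) set \<Rightarrow> (real ^ 'm \<Rightarrow> 'n phase \<Rightarrow> 'n phase) \<Rightarrow> bool" where
  "canonical_on U \<Phi> \<longleftrightarrow>
     (\<forall>(\<epsilon>, z)\<in>U. \<forall>v w.
        symplectic_form (frechet_derivative (\<Phi> \<epsilon>) (at z) v) (frechet_derivative (\<Phi> \<epsilon>) (at z) w)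
        = symplectic_form v w)"

text \<open>
  Normal form to order \<open>n\<^sub>0 + 1\<close> of the Hamiltonian system with Hamiltonian \<open>h \<epsilon>\<close>;
  the parameter \<open>\<epsilon>\<close> is counted in the degree of \<open>N\<close> and in the order of \<open>R\<close>.
\<close>

definition elphick_normal_form ::
    "nat \<Rightarrow> (real ^ 'm::finite \<Rightarrow> real ^ ('n::finite + 'n) \<Rightarrow> real) \<Rightarrow> bool" where
  "elphick_normal_form n\<^sub>0 h \<longleftrightarrow>
     (let H\<^sub>2 = quadratic_part (h 0);
          A = matrix (hamiltonian_vector_field H\<^sub>2)
      in \<exists>N R. polynomial_degree_le (n\<^sub>0 + 1) (\<lambda>(x, \<epsilon>). N x \<epsilon>) \<and>
           (\<forall>t x \<epsilon>. N (mat_exp (t *\<^sub>R transpose A) *v x) \<epsilon> = N x \<epsilon>) \<and>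
           (\<lambda>(x, \<epsilon>). R x \<epsilon>) \<in> O[nhds 0](\<lambda>(x, \<epsilon>). norm (x, \<epsilon>) ^ (n\<^sub>0 + 2)) \<and>
           (\<forall>\<^sub>F (x, \<epsilon>) in nhds 0. h \<epsilon> x = H\<^sub>2 x + N x \<epsilon> + R x \<epsilon>))"

end

theory Submission
  imports Defs
begin

text \<open>
  The change of variables can be taken independent of \<open>q\<^sub>0\<close> and equal to the identity on
  \<open>(q\<^sub>0, p\<^sub>0)\<close>, so that only the Taylor polynomial of \<open>H\<close> on the slice \<open>q\<^sub>0 = 0\<close> has to be
  normalized. Every polynomial Hamiltonian is a sum of multiples of \<open>\<epsilon>\<^sup>v (w \<bullet> x)\<^sup>i\<close>,
  whose flows are polynomial symplectic shears with explicit inverses; compositions of such shears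
  replace the flows or generating functions of the usual proof.
  A shear of this kind changes \<open>H\<close> to leading order by a Poisson bracket with \<open>H\<^sub>2\<close>, and these brackets
  and the polynomials invariant under the flow of the transposed linear field together span all polynomials.
  Since \<open>H\<close> may contain terms bilinear in \<open>\<epsilon>\<close> and \<open>x\<close>, the induction is not on the degree but on a
  weight which counts \<open>\<epsilon>\<close> twice.
\<close>

text \<open>Degree fails as an induction parameter because the bracket of a generator with a term
  \<epsilon> x has the same degree as its bracket with H_2, so cancelling one term would create
  others of equal degree. For the weight, \<epsilon> x counts 3 and only H_2 acts at leading weight.
  Weight and degree then have to be traded: a monomial of weight at least 2 n_0 + 3 has degree at
  least n_0 + 2, so the weights from 3 to 2 n_0 + 2 are treated, and monomials whose degree already
  exceeds n_0 + 1 are set aside. The spanning claim is an adjointness statement. Coefficients are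
  indexed by words in the coordinates, so that the coefficients of (w . x)^n are the word monomials
  evaluated at w; pairing a coefficient vector with those of (w . x)^n then evaluates its polynomial
  at w. Since the shears are polynomial bijections of the whole space for every \<epsilon>, no
  domain shrinks along the induction.\<close>

section \<open>Finitely often differentiable functions\<close>

lemma Ck_on_cong:
  assumes "open S" "\<And>x. x \<in> S \<Longrightarrow> f x = g x" "Ck_on k S f"
  shows "Ck_on k S g"
  using assms(2,3)
proof (induction k arbitrary: f g)
  case 0
  then show ?case using continuous_on_cong[of S S f g] by auto
next
  case (Suc k)
  have d: "(g has_derivative frechet_derivative f (at x)) (at x)" if "x \<in> S" for x
    using Suc.prems that \<open>open S\<close>
    by (auto simp: frechet_derivative_works intro: has_derivative_transform_within_open[of f])
  have "g differentiable at x" if "x \<in> S" for x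
    using d[OF that] differentiable_def by blast
  moreover have "Ck_on k S (\<lambda>x. frechet_derivative g (at x) v)" for v
    using Suc.IH[of "\<lambda>x. frechet_derivative f (at x) v" "\<lambda>x. frechet_derivative g (at x) v"]
      Suc.prems d frechet_derivative_at[OF d] by auto
  ultimately show ?case by simp
qed

text \<open>\<open>Ck_on\<close> speaks of \<open>frechet_derivative\<close>; this rule admits any
  derivative formula valid on the open set.\<close>

lemma Ck_on_SucI:
  assumes "open S" "\<And>x. x \<in> S \<Longrightarrow> (f has_derivative f' x) (at x)"
    "\<And>v. Ck_on k S (\<lambda>x. f' x v)"
  shows "Ck_on (Suc k) S f"
proof -
  have "Ck_on k S (\<lambda>x. frechet_derivative f (at x) v)" for v
    using assms(3)[of v] frechet_derivative_at[OF assms(2)]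
    by (intro Ck_on_cong[OF assms(1) _ assms(3)[of v]]) auto
  then show ?thesis using assms(2) by (auto simp: differentiable_def)
qed

lemma Ck_on_SucD:
  assumes "open S" "Ck_on (Suc k) S f"
  shows "Ck_on k S f"
  using assms(2)
proof (induction k arbitrary: f)
  case 0
  then show ?case
    using differentiable_imp_continuous_on[of f S]
    by (auto simp: differentiable_on_def differentiable_at_withinI)
next
  case (Suc k)
  then show ?case by simp
qed

lemma Ck_on_le:
  assumes "open S" "Ck_on k S f" "j \<le> k"
  shows "Ck_on j S f"
  using assms(3,2) by (induction rule: inc_induct) (auto intro: Ck_on_SucD[OF assms(1)])

lemma Ck_on_add:
  assumes "open S" "Ck_on k S f" "Ck_on k S g"
  shows "Ck_on k S (\<lambda>x. f x + g x)"
  using assms(2,3)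
proof (induction k arbitrary: f g)
  case 0
  then show ?case by (auto intro: continuous_on_add)
next
  case (Suc k)
  show ?case
    by (rule Ck_on_SucI[OF assms(1), where f'="\<lambda>x v. frechet_derivative f (at x) v + frechet_derivative g (at x) v"])
      (use Suc in \<open>auto intro!: derivative_eq_intros simp: frechet_derivative_works\<close>)
qed

lemma Ck_on_const: "open S \<Longrightarrow> Ck_on k S (\<lambda>x. c)"
proof (induction k arbitrary: c)
  case (Suc k)
  show ?case
    by (rule Ck_on_SucI[where f'="\<lambda>x v. 0"]) (use Suc in \<open>auto\<close>)
qed auto

lemma Ck_on_sum:
  assumes "open S" "\<And>i. i \<in> I \<Longrightarrow> Ck_on k S (f i)"
  shows "Ck_on k S (\<lambda>x. \<Sum>i\<in>I. f i x)"
  using assms(2) by (induction I rule: infinite_finite_induct) (auto intro: Ck_on_const Ck_on_add assms(1))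

lemma Ck_on_mult:
  fixes f g :: "'a::real_normed_vector \<Rightarrow> real"
  assumes "open S" "Ck_on k S f" "Ck_on k S g"
  shows "Ck_on k S (\<lambda>x. f x * g x)"
  using assms(2,3)
proof (induction k arbitrary: f g)
  case 0
  then show ?case by (auto intro: continuous_on_mult)
next
  case (Suc k)
  show ?case
  proof (rule Ck_on_SucI[OF assms(1),
      where f'="\<lambda>x v. f x * frechet_derivative g (at x) v + frechet_derivative f (at x) v * g x"])
    show "((\<lambda>x. f x * g x) has_derivative
        (\<lambda>v. f x * frechet_derivative g (at x) v + frechet_derivative f (at x) v * g x)) (at x)"
      if "x \<in> S" for x
      using Suc.prems that by (auto intro!: has_derivative_mult simp: frechet_derivative_works)
    show "Ck_on k S (\<lambda>x. f x * frechet_derivative g (at x) v + frechet_derivative f (at x) v * g x)" for v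
      using Suc.prems Ck_on_SucD[OF assms(1) Suc.prems(1)] Ck_on_SucD[OF assms(1) Suc.prems(2)]
      by (intro Ck_on_add[OF assms(1)] Suc.IH) auto
  qed
qed

section \<open>Polynomial maps and substitution\<close>

lemma real_polynomial_function_derivative:
  assumes "real_polynomial_function p"
  shows "\<exists>p'. (\<forall>x. (p has_derivative p' x) (at x)) \<and> (\<forall>v. real_polynomial_function (\<lambda>x. p' x v))"
  using assms
proof induction
  case (linear f)
  then show ?case
    by (intro exI[of _ "\<lambda>x. f"]) (auto intro: bounded_linear_imp_has_derivative)
next
  case (const c)
  then show ?case by (intro exI[of _ "\<lambda>x v. 0"]) auto
next
  case (add f g)
  then obtain f' g' where "\<forall>x. (f has_derivative f' x) (at x)" "\<forall>v. real_polynomial_function (\<lambda>x. f' x v)"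
    "\<forall>x. (g has_derivative g' x) (at x)" "\<forall>v. real_polynomial_function (\<lambda>x. g' x v)" by blast
  then show ?case
    by (intro exI[of _ "\<lambda>x v. f' x v + g' x v"]) (auto intro!: derivative_eq_intros)
next
  case (mult f g)
  then obtain f' g' where "\<forall>x. (f has_derivative f' x) (at x)" "\<forall>v. real_polynomial_function (\<lambda>x. f' x v)"
    "\<forall>x. (g has_derivative g' x) (at x)" "\<forall>v. real_polynomial_function (\<lambda>x. g' x v)" by blast
  with mult.hyps show ?case
    by (intro exI[of _ "\<lambda>x v. f x * g' x v + f' x v * g x"] conjI allI has_derivative_mult
        real_polynomial_function.intros(3,4)) auto
qed

lemma polynomial_function_derivative:
  fixes p :: "'a::real_normed_vector \<Rightarrow> 'b::euclidean_space"
  assumes "polynomial_function p"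
  obtains p' where "\<And>x. (p has_derivative p' x) (at x)" "\<And>v. polynomial_function (\<lambda>x. p' x v)"
proof -
  have "\<forall>b\<in>Basis. real_polynomial_function (\<lambda>x. p x \<bullet> b)"
    using assms polynomial_function_iff_Basis_inner by blast
  then have "\<forall>b\<in>Basis. \<exists>q. (\<forall>x. ((\<lambda>x. p x \<bullet> b) has_derivative q x) (at x)) \<and> (\<forall>v. real_polynomial_function (\<lambda>x. q x v))"
    using real_polynomial_function_derivative by blast
  then obtain q where q: "\<And>b x. b \<in> Basis \<Longrightarrow> ((\<lambda>x. p x \<bullet> b) has_derivative q b x) (at x)"
     "\<And>b v. b \<in> Basis \<Longrightarrow> real_polynomial_function (\<lambda>x. q b x v)" by metis
  have "(p has_derivative (\<lambda>v. \<Sum>b\<in>Basis. q b x v *\<^sub>R b)) (at x)" for x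
    using q(1) by (subst has_derivative_componentwise_within) (auto simp: inner_sum_left inner_Basis if_distrib cong: if_cong)
  moreover have "polynomial_function (\<lambda>x. \<Sum>b\<in>Basis. q b x v *\<^sub>R b)" for v
    using q(2) by (auto intro!: polynomial_function_sum polynomial_function_mult simp: real_polynomial_function_eq[symmetric])
  ultimately show ?thesis by (rule that)
qed

lemma Ck_on_polynomial_function:
  fixes p :: "'a::euclidean_space \<Rightarrow> 'b::euclidean_space"
  assumes "open S" "polynomial_function p"
  shows "Ck_on k S p"
  using assms(2)
proof (induction k arbitrary: p)
  case 0
  then show ?case by (simp add: continuous_on_polymonial_function)
next
  case (Suc k)
  obtain p' where "\<And>x. (p has_derivative p' x) (at x)" "\<And>v. polynomial_function (\<lambda>x. p' x v)"
    using polynomial_function_derivative[OF Suc.prems] by blast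
  then show ?case using Suc.IH by (intro Ck_on_SucI[OF assms(1), where f'=p']) auto
qed

lemma smooth_on_polynomial_function:
  fixes p :: "'a::euclidean_space \<Rightarrow> 'b::euclidean_space"
  shows "open S \<Longrightarrow> polynomial_function p \<Longrightarrow> smooth_on S p"
  by (simp add: smooth_on_def Ck_on_polynomial_function)

lemma linear_Basis_expansion:
  fixes f :: "'a::euclidean_space \<Rightarrow> real"
  assumes "linear f"
  shows "f v = (\<Sum>b\<in>Basis. (v \<bullet> b) * f b)"
  by (subst euclidean_representation[of v, symmetric], subst linear_sum[OF assms])
    (simp add: linear_scale[OF assms])

text \<open>The inner map stays fixed through the induction: by the chain rule a directional
  derivative is a finite sum of polynomials times derivatives of \<open>f\<close> composed with the
  same \<open>p\<close>. Every substitution into the Hamiltonian below is of this kind.\<close>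

lemma Ck_on_compose_polynomial:
  fixes p :: "'a::euclidean_space \<Rightarrow> 'b::euclidean_space" and f :: "'b \<Rightarrow> real"
  assumes "open S" "open T" "polynomial_function p" "p ` S \<subseteq> T" "Ck_on k T f"
  shows "Ck_on k S (\<lambda>x. f (p x))"
  using assms(5)
proof (induction k arbitrary: f)
  case 0
  then show ?case
    using continuous_on_compose2[of T f S p] assms(3,4) by (simp add: continuous_on_polymonial_function)
next
  case (Suc k)
  obtain p' where p': "\<And>x. (p has_derivative p' x) (at x)" "\<And>v. polynomial_function (\<lambda>x. p' x v)"
    using polynomial_function_derivative[OF assms(3)] by blast
  have f': "(f has_derivative frechet_derivative f (at (p x))) (at (p x))" if "x \<in> S" for x
    using Suc.prems assms(4) that by (auto simp: frechet_derivative_works)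
  show ?case
  proof (rule Ck_on_SucI[OF assms(1),
        where f'="\<lambda>x v. \<Sum>b\<in>Basis. (p' x v \<bullet> b) * frechet_derivative f (at (p x)) b"])
    show "((\<lambda>x. f (p x)) has_derivative
        (\<lambda>v. \<Sum>b\<in>Basis. (p' x v \<bullet> b) * frechet_derivative f (at (p x)) b)) (at x)" if "x \<in> S" for x
      using has_derivative_compose[OF p'(1) f'[OF that]]
      by (subst (asm) linear_Basis_expansion[OF has_derivative_linear[OF f'[OF that]]])
    show "Ck_on k S (\<lambda>x. \<Sum>b\<in>Basis. (p' x v \<bullet> b) * frechet_derivative f (at (p x)) b)" for v
    proof (intro Ck_on_sum Ck_on_mult assms(1))
      show "Ck_on k S (\<lambda>x. p' x v \<bullet> b)" for b
        by (intro Ck_on_polynomial_function polynomial_function_inner assms(1) p'(2))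
      show "Ck_on k S (\<lambda>x. frechet_derivative f (at (p x)) b)" for b
        using Suc.prems by (intro Suc.IH[of "\<lambda>y. frechet_derivative f (at y) b"]) auto
    qed
  qed
qed

section \<open>Taylor expansion\<close>

text \<open>The \<open>j\<close>-th derivative of \<open>f\<close> at \<open>x\<close> applied
  \<open>j\<close> times to \<open>z\<close>. Expanding each direction in the basis keeps the
  differentiated directions constant, as \<open>Ck_on\<close> requires, and displays a homogeneous
  polynomial in \<open>z\<close>.\<close>

primrec iter_deriv :: "nat \<Rightarrow> ('a::euclidean_space \<Rightarrow> real) \<Rightarrow> 'a \<Rightarrow> 'a \<Rightarrow> real" where
  "iter_deriv 0 f z x = f x"
| "iter_deriv (Suc j) f z x =
     (\<Sum>b\<in>Basis. (z \<bullet> b) * iter_deriv j (\<lambda>y. frechet_derivative f (at y) b) z x)"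

lemma iter_deriv_has_derivative:
  assumes "Ck_on (Suc j) S f" "t *\<^sub>R z \<in> S"
  shows "((\<lambda>t. iter_deriv j f z (t *\<^sub>R z)) has_real_derivative iter_deriv (Suc j) f z (t *\<^sub>R z)) (at t)"
  using assms(1)
proof (induction j arbitrary: f)
  case 0
  then have f: "(f has_derivative frechet_derivative f (at (t *\<^sub>R z))) (at (t *\<^sub>R z))"
    using assms(2) by (auto simp: frechet_derivative_works)
  have "((\<lambda>t. t *\<^sub>R z) has_derivative (\<lambda>s. s *\<^sub>R z)) (at t)"
    by (auto intro!: derivative_eq_intros)
  from has_derivative_compose[OF this f]
  have "((\<lambda>t. f (t *\<^sub>R z)) has_derivative (\<lambda>s. frechet_derivative f (at (t *\<^sub>R z)) z * s)) (at t)"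
    by (simp add: linear_scale[OF has_derivative_linear[OF f]] mult.commute)
  then show ?case
    unfolding has_field_derivative_def iter_deriv.simps
    by (subst (asm) (1) linear_Basis_expansion[OF has_derivative_linear[OF f]])
next
  case (Suc j)
  have "((\<lambda>t. iter_deriv j (\<lambda>y. frechet_derivative f (at y) b) z (t *\<^sub>R z)) has_real_derivative
     iter_deriv (Suc j) (\<lambda>y. frechet_derivative f (at y) b) z (t *\<^sub>R z)) (at t)" for b
    using Suc by (metis Ck_on.simps(2))
  then show ?case
    unfolding iter_deriv.simps(2)[of j f] iter_deriv.simps(2)[of "Suc j" f]
    by (intro DERIV_sum DERIV_cmult)
qed

lemma iter_deriv_bound:
  assumes "Ck_on j S f" "compact K" "K \<subseteq> S"
  obtains C where "\<And>x z. x \<in> K \<Longrightarrow> \<bar>iter_deriv j f z x\<bar> \<le> C * norm z ^ j"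
proof -
  have "\<exists>C. \<forall>x\<in>K. \<forall>z. \<bar>iter_deriv j f z x\<bar> \<le> C * norm z ^ j"
    using assms(1)
  proof (induction j arbitrary: f)
    case 0
    then have "compact (f ` K)"
      using assms(2,3) by (auto intro: compact_continuous_image continuous_on_subset)
    then obtain B where "\<forall>y\<in>f ` K. norm y \<le> B"
      using compact_imp_bounded bounded_iff by blast
    then show ?case by (intro exI[of _ B]) simp
  next
    case (Suc j)
    have "\<forall>b. \<exists>C. \<forall>x\<in>K. \<forall>z. \<bar>iter_deriv j (\<lambda>y. frechet_derivative f (at y) b) z x\<bar> \<le> C * norm z ^ j"
      using Suc by simp
    then obtain C where C: "\<And>b x z. x\<in>K \<Longrightarrow> \<bar>iter_deriv j (\<lambda>y. frechet_derivative f (at y) b) z x\<bar> \<le> C b * norm z ^ j"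
      by metis
    have "\<bar>iter_deriv (Suc j) f z x\<bar> \<le> (\<Sum>b\<in>Basis. C b) * norm z ^ Suc j" if "x \<in> K" for x z
    proof -
      have "\<bar>iter_deriv (Suc j) f z x\<bar> \<le> (\<Sum>b\<in>Basis. norm z * (C b * norm z ^ j))"
        unfolding iter_deriv.simps
        by (rule order_trans[OF sum_abs], intro sum_mono)
          (auto simp: abs_mult intro!: mult_mono C that Basis_le_norm)
      then show ?thesis by (simp add: sum_distrib_left sum_distrib_right mult_ac)
    qed
    then show ?case by blast
  qed
  then show ?thesis using that by blast
qed

text \<open>Maclaurin's formula for \<open>t \<mapsto> f (t *\<^sub>R z)\<close> on the unit
  interval; the constant is uniform in \<open>z\<close> because the last derivative is bounded on a
  compact ball.\<close>

lemma Taylor_iter_deriv: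
  fixes f :: "'a::euclidean_space \<Rightarrow> real"
  assumes "open S" "0 \<in> S" "Ck_on n S f" "0 < n"
  obtains C \<delta> where "0 < \<delta>"
    "\<And>z. norm z \<le> \<delta> \<Longrightarrow> \<bar>f z - (\<Sum>j<n. iter_deriv j f z 0 / fact j)\<bar> \<le> C * norm z ^ n"
proof -
  obtain \<delta> where \<delta>: "0 < \<delta>" "cball 0 \<delta> \<subseteq> S"
    using assms open_contains_cball by metis
  obtain C where C: "\<And>x z. x \<in> cball 0 \<delta> \<Longrightarrow> \<bar>iter_deriv n f z x\<bar> \<le> C * norm z ^ n"
    using iter_deriv_bound[OF assms(3) compact_cball \<delta>(2)] by blast
  have "\<bar>f z - (\<Sum>j<n. iter_deriv j f z 0 / fact j)\<bar> \<le> C / fact n * norm z ^ n" if "norm z \<le> \<delta>" for z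
  proof -
    have in_ball: "t *\<^sub>R z \<in> cball 0 \<delta>" if "0 \<le> t" "t \<le> 1" for t
      using that \<open>norm z \<le> \<delta>\<close> mult_mono[of t 1 "norm z" \<delta>] by simp
    have "\<exists>t>0. t < 1 \<and> f (1 *\<^sub>R z) = (\<Sum>m<n. iter_deriv m f z (0 *\<^sub>R z) / fact m * 1 ^ m) + iter_deriv n f z (t *\<^sub>R z) / fact n * 1 ^ n"
      using in_ball \<delta>(2) assms
      by (intro Maclaurin[where diff="\<lambda>m t. iter_deriv m f z (t *\<^sub>R z)" and f="\<lambda>t. f (t *\<^sub>R z)"])
        (auto intro!: iter_deriv_has_derivative[where S=S] intro: Ck_on_le simp del: iter_deriv.simps(2))
    then obtain t where t: "0 < t" "t < 1" "f z = (\<Sum>m<n. iter_deriv m f z 0 / fact m) + iter_deriv n f z (t *\<^sub>R z) / fact n"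
      by auto
    then have "\<bar>f z - (\<Sum>j<n. iter_deriv j f z 0 / fact j)\<bar> = \<bar>iter_deriv n f z (t *\<^sub>R z)\<bar> / fact n" by simp
    also have "\<dots> \<le> C * norm z ^ n / fact n"
      using t by (intro divide_right_mono C in_ball) auto
    finally show ?thesis by simp
  qed
  then show ?thesis using that \<delta>(1) by blast
qed

lemma iter_deriv_scaleR: "iter_deriv j f (t *\<^sub>R z) x = t ^ j * iter_deriv j f z x"
  by (induction j arbitrary: f) (simp_all add: sum_distrib_left mult_ac)

text \<open>Letting \<open>t\<close> tend to 0 from the right isolates the constant coefficient;
  once it is gone, division by \<open>t\<close> leaves the same situation one degree lower.\<close>

lemma coeffs_zero_of_small:
  fixes a :: "nat \<Rightarrow> real"
  assumes "0 < \<delta>" "\<And>t. 0 < t \<Longrightarrow> t < \<delta> \<Longrightarrow> \<bar>\<Sum>j<n. a j * t ^ j\<bar> \<le> C * t ^ n" "j < n"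
  shows "a j = 0"
  using assms(2,3)
proof (induction n arbitrary: a j)
  case (Suc n)
  have ev: "\<forall>\<^sub>F t in at_right 0. 0 < t \<and> t < \<delta>"
    using assms(1) by (auto simp: eventually_at_right[of 0 \<delta>])
  have 0: "a 0 = 0"
  proof -
    have 1: "((\<lambda>t. \<Sum>j<Suc n. a j * t ^ j) \<longlongrightarrow> (\<Sum>j<Suc n. a j * 0 ^ j)) (at_right 0)"
      by (intro tendsto_intros)
    have "((\<lambda>t. C * t ^ Suc n) \<longlongrightarrow> C * 0 ^ Suc n) (at_right 0)"
      by (intro tendsto_intros)
    then have 2: "((\<lambda>t. C * t ^ Suc n) \<longlongrightarrow> 0) (at_right 0)" by simp
    have "\<forall>\<^sub>F t in at_right 0. norm (\<Sum>j<Suc n. a j * t ^ j) \<le> C * t ^ Suc n"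
      by (rule eventually_mono[OF ev]) (use Suc.prems(1) in \<open>simp del: sum.lessThan_Suc\<close>)
    then have "((\<lambda>t. \<Sum>j<Suc n. a j * t ^ j) \<longlongrightarrow> 0) (at_right 0)"
      by (rule Lim_null_comparison) (rule 2)
    with 1 have "(\<Sum>j<Suc n. a j * 0 ^ j) = 0"
      using tendsto_unique[OF trivial_limit_at_right_real] by blast
    then show ?thesis by (simp add: sum.lessThan_Suc_shift del: sum.lessThan_Suc)
  qed
  have "a (Suc i) = 0" if "i < n" for i
  proof (rule Suc.IH[OF _ that])
    fix t :: real assume t: "0 < t" "t < \<delta>"
    have "(\<Sum>j<Suc n. a j * t ^ j) = t * (\<Sum>j<n. a (Suc j) * t ^ j)"
      using 0 by (simp add: sum.lessThan_Suc_shift sum_distrib_left mult_ac del: sum.lessThan_Suc)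
    then have "t * \<bar>\<Sum>j<n. a (Suc j) * t ^ j\<bar> \<le> t * (C * t ^ n)"
      using Suc.prems(1)[OF t] t by (simp add: abs_mult mult_ac)
    then show "\<bar>\<Sum>j<n. a (Suc j) * t ^ j\<bar> \<le> C * t ^ n" using t by simp
  qed
  with 0 Suc.prems(2) show ?case by (cases j) auto
qed simp

section \<open>Orthogonal projection and the homological equation\<close>

text \<open>Induction on the number of coordinates: the members of \<open>S\<close> vanishing at the
  new coordinate form a subspace of codimension at most one, to which one orthogonal direction is
  added. The functions live on the whole type, and only their values on \<open>I\<close> enter the
  pairing.\<close>

lemma finite_orthogonal_decomposition:
  fixes S :: "('i \<Rightarrow> real) set" and v :: "'i \<Rightarrow> real"
  assumes "finite I" "(\<lambda>i. 0) \<in> S"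
    "\<And>a b s t. s \<in> S \<Longrightarrow> t \<in> S \<Longrightarrow> (\<lambda>i. a * s i + b * t i) \<in> S"
  shows "\<exists>s\<in>S. \<forall>t\<in>S. (\<Sum>i\<in>I. (v i - s i) * t i) = 0"
  using assms
proof (induction I arbitrary: S v rule: finite_induct)
  case empty
  then show ?case by auto
next
  case (insert i I)
  define S0 where "S0 = {s\<in>S. s i = 0}"
  have S0: "(\<lambda>i. 0) \<in> S0" "\<And>a b s t. s \<in> S0 \<Longrightarrow> t \<in> S0 \<Longrightarrow> (\<lambda>i. a * s i + b * t i) \<in> S0"
    using insert.prems by (auto simp: S0_def)
  \<comment> \<open>Members of \<open>S0\<close> vanish at \<open>i\<close>, so the sum over
    \<open>I\<close> from the induction hypothesis equals the sum over
    \<open>insert i I\<close>.\<close>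
  have proj: "\<exists>s\<in>S0. \<forall>t\<in>S0. (\<Sum>j\<in>insert i I. (v j - s j) * t j) = 0" for v
    using insert.IH[OF S0, of v] insert.hyps by (force simp: S0_def)
  show ?case
  proof (cases "S = S0")
    case True
    with proj show ?thesis by simp
  next
    case False
    then obtain e0 where e0: "e0 \<in> S" "e0 i \<noteq> 0" by (auto simp: S0_def)
    obtain f where f: "f \<in> S0" "\<And>t. t \<in> S0 \<Longrightarrow> (\<Sum>j\<in>insert i I. (e0 j - f j) * t j) = 0"
      using proj by blast
    \<comment> \<open>\<open>e0\<close> minus its projection onto \<open>S0\<close> is orthogonal to
      \<open>S0\<close>; its entry at \<open>i\<close> is still that of \<open>e0\<close>, so its
      squared length \<open>ee\<close> is positive.\<close>
    define e where "e = (\<lambda>j. e0 j - f j)"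
    have e: "e \<in> S" "e i \<noteq> 0"
      using insert.prems(2)[of e0 f 1 "-1"] e0 f(1) by (auto simp: e_def S0_def)
    have e_orth: "(\<Sum>j\<in>insert i I. e j * t j) = 0" if "t \<in> S0" for t
      using f(2)[OF that] by (simp add: e_def)
    define ee where "ee = (\<Sum>j\<in>insert i I. e j * e j)"
    have "e i * e i \<le> ee" unfolding ee_def
      using insert.hyps(1) by (intro member_le_sum) auto
    moreover have "0 < e i * e i" using e(2) not_real_square_gt_zero by blast
    ultimately have ee: "ee \<noteq> 0" by linarith
    obtain s where s: "s \<in> S0" "\<And>t. t \<in> S0 \<Longrightarrow> (\<Sum>j\<in>insert i I. (v j - s j) * t j) = 0"
      using proj by blast
    define c where "c = (\<Sum>j\<in>insert i I. v j * e j) / ee"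
    from c_def have ce: "(\<Sum>j\<in>insert i I. v j * e j) = c * ee"
      unfolding nonzero_eq_divide_eq[OF ee] by (rule sym)
    have "(\<lambda>j. s j + c * e j) \<in> S"
      using insert.prems(2)[of s e 1 c] s(1) e(1) by (auto simp: S0_def)
    moreover have "(\<Sum>j\<in>insert i I. (v j - (s j + c * e j)) * t j) = 0" if t: "t \<in> S" for t
    proof -
      \<comment> \<open>\<open>r\<close> is chosen so that \<open>t0 = t - r e\<close> vanishes at
        \<open>i\<close> and hence lies in \<open>S0\<close>; orthogonality is then checked on
        \<open>t0\<close> and on \<open>e\<close> separately.\<close>
      define r where "r = t i / e i"
      define t0 where "t0 = (\<lambda>j. t j - r * e j)"
      have t0: "t0 \<in> S0"
        using insert.prems(2)[OF t e(1), of 1 "-r"] e(2) by (simp add: t0_def S0_def r_def)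
      have "(\<Sum>j\<in>insert i I. (v j - (s j + c * e j)) * t j)
        = (\<Sum>j\<in>insert i I. ((v j - s j) * t0 j - c * (e j * t0 j))
            + r * (v j * e j - e j * s j - c * (e j * e j)))"
        by (rule sum.cong) (simp_all add: t0_def algebra_simps)
      also have "\<dots> = (\<Sum>j\<in>insert i I. (v j - s j) * t0 j) - c * (\<Sum>j\<in>insert i I. e j * t0 j)
          + r * ((\<Sum>j\<in>insert i I. v j * e j) - (\<Sum>j\<in>insert i I. e j * s j) - c * ee)"
        unfolding ee_def by (simp only: sum.distrib sum_subtractf sum_distrib_left[symmetric])
      also have "\<dots> = 0"
        unfolding s(2)[OF t0] e_orth[OF t0] e_orth[OF s(1)] ce by simp
      finally show ?thesis .
    qed
    ultimately show ?thesis by (intro bexI ballI)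
  qed
qed

section \<open>Polynomials as combinations of words in the coordinates\<close>

definition word_monomial :: "'k list \<Rightarrow> real ^ 'k \<Rightarrow> real" where
  "word_monomial u x = (\<Prod>a\<leftarrow>u. x $ a)"

primrec word_derivative :: "'k list \<Rightarrow> real ^ 'k \<Rightarrow> real ^ 'k \<Rightarrow> real" where
  "word_derivative [] x y = 0"
| "word_derivative (a # u) x y = x $ a * word_derivative u x y + y $ a * word_monomial u x"

lemma word_monomial_simps [simp]:
  "word_monomial [] x = 1" "word_monomial (a # u) x = x $ a * word_monomial u x"
  by (simp_all add: word_monomial_def)

lemma word_monomial_append: "word_monomial (u @ v) x = word_monomial u x * word_monomial v x"
  by (simp add: word_monomial_def)

lemma word_monomial_has_derivative:
  "(word_monomial u has_derivative word_derivative u x) (at x)" for x :: "real ^ 'k::finite"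
proof (induction u)
  case (Cons a u)
  have "((\<lambda>x. x $ a) has_derivative (\<lambda>y. y $ a)) (at x)"
    by (intro bounded_linear_imp_has_derivative bounded_linear_vec_nth)
  from has_derivative_mult[OF this Cons.IH]
  show ?case by (simp add: word_monomial_def[abs_def])
qed (simp add: word_monomial_def[abs_def])

lemma finite_words: "finite {u :: 'k::finite list. length u = n}"
  using finite_lists_length_eq[of "UNIV :: 'k set" n] by simp

lemma sum_words_Suc:
  "(\<Sum>u | length (u :: 'k::finite list) = Suc n. f u) = (\<Sum>a\<in>UNIV. \<Sum>u | length u = n. f (a # u))"
proof -
  have "{u :: 'k list. length u = Suc n} = (\<lambda>(a, u). a # u) ` (UNIV \<times> {u. length u = n})"
    by (force simp: length_Suc_conv image_iff)
  moreover have "inj_on (\<lambda>(a, u). a # u) (UNIV \<times> {u :: 'k list. length u = n})"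
    by (auto intro: inj_onI)
  ultimately show ?thesis
    by (simp add: sum.reindex sum.cartesian_product case_prod_unfold o_def)
qed

text \<open>Multiplying out without collecting equal monomials gives no multinomial factors; with
  multi-indices the pairing of coefficients would need them as weights.\<close>

lemma inner_power_words:
  "(w \<bullet> x) ^ n = (\<Sum>u | length u = n. word_monomial u w * word_monomial u x)"
  for w x :: "real ^ 'k::finite"
proof (induction n)
  case (Suc n)
  show ?case
    unfolding power_Suc Suc sum_words_Suc
    by (simp add: inner_vec_def sum_product mult_ac)
qed simp

text \<open>This is the derivative of \<open>inner_power_words\<close> with respect to
  \<open>w\<close> in the direction \<open>y\<close>. For \<open>n = 0\<close> both sides vanish, so
  the truncated exponent is harmless.\<close>

lemma inner_power_word_derivative:
  "real n * (w \<bullet> x) ^ (n - 1) * (y \<bullet> x) = (\<Sum>u | length u = n. word_derivative u w y * word_monomial u x)"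
  for w x y :: "real ^ 'k::finite"
proof (induction n)
  case (Suc n)
  have "(\<Sum>u | length u = Suc n. word_derivative u w y * word_monomial u x)
    = (w \<bullet> x) * (\<Sum>u | length u = n. word_derivative u w y * word_monomial u x)
      + (y \<bullet> x) * (w \<bullet> x) ^ n"
    unfolding sum_words_Suc inner_power_words[of w x n]
    by (simp add: inner_vec_def sum_product algebra_simps sum.distrib)
  also have "\<dots> = real (Suc n) * (w \<bullet> x) ^ (Suc n - 1) * (y \<bullet> x)"
    unfolding Suc[symmetric] by (cases n) (simp_all add: algebra_simps)
  finally show ?case by simp
qed simp

text \<open>
  The pairing of coefficients of words makes the adjoint of \<open>p \<mapsto> Dp(x)(Ax)\<close> equal to
  \<open>p \<mapsto> Dp(x)(A\<^sup>Tx)\<close>, so that the orthogonal projection of a monomial onto the span of the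
  functions \<open>x \<mapsto> D(w \<bullet> x)\<^sup>n(Ax)\<close> leaves an error in the kernel of the latter.
\<close>

lemma homological_equation:
  fixes A :: "real ^ 'k ^ 'k::finite" and u :: "'k list"
  obtains c :: "'k list \<Rightarrow> real" and ws :: "(real \<times> (real ^ 'k)) list" where
    "\<And>x. word_monomial u x = (\<Sum>v | length v = length u. c v * word_monomial v x)
       + (\<Sum>(a, w)\<leftarrow>ws. a * (real (length u) * (w \<bullet> x) ^ (length u - 1) * ((transpose A *v w) \<bullet> x)))"
    "\<And>x. (\<Sum>v | length v = length u. c v * word_derivative v x (transpose A *v x)) = 0"
proof -
  define W where "W = {v :: 'k list. length v = length u}"
  \<comment> \<open>These are the word coefficients of the derivative of
    \<open>(w \<bullet> x) ^ length u\<close> along \<open>A *v x\<close>, because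
    \<open>w \<bullet> (A *v x)\<close> equals
    \<open>(transpose A *v w) \<bullet> x\<close>.\<close>
  define T where "T = (\<lambda>w v. word_derivative v w (transpose A *v w))"
  define S where "S = range (\<lambda>ws. \<lambda>v. \<Sum>(a, w)\<leftarrow>ws. a * T w v)"
  have "\<exists>s\<in>S. \<forall>t\<in>S. (\<Sum>v\<in>W. ((if v = u then 1 else 0) - s v) * t v) = 0"
  proof (rule finite_orthogonal_decomposition)
    show "finite W" by (simp add: W_def finite_words)
    show "(\<lambda>i. 0) \<in> S" unfolding S_def by (rule range_eqI[of _ _ "[]"]) simp
    fix a b s t assume "s \<in> S" "t \<in> S"
    then obtain ws zs where *: "s = (\<lambda>v. \<Sum>(a, w)\<leftarrow>ws. a * T w v)" "t = (\<lambda>v. \<Sum>(a, w)\<leftarrow>zs. a * T w v)"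
      by (auto simp: S_def)
    have scale: "a * (\<Sum>(a, w)\<leftarrow>ws. a * T w v) = (\<Sum>(a, w)\<leftarrow>map (\<lambda>(c, w). (a * c, w)) ws. a * T w v)"
      for a v and ws by (induction ws) (auto simp: algebra_simps)
    show "(\<lambda>i. a * s i + b * t i) \<in> S"
      unfolding S_def
      by (rule range_eqI[of _ _ "map (\<lambda>(c, w). (a * c, w)) ws @ map (\<lambda>(c, w). (b * c, w)) zs"])
        (simp only: * scale map_append sum_list_append)
  qed
  then obtain ws where ws: "\<And>t. t \<in> S \<Longrightarrow> (\<Sum>v\<in>W. ((if v = u then 1 else 0) - (\<Sum>(a, w)\<leftarrow>ws. a * T w v)) * t v) = 0"
    by (auto simp: S_def)
  define c where "c = (\<lambda>v. (if v = u then 1 else 0) - (\<Sum>(a, w)\<leftarrow>ws. a * T w v))"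
  \<comment> \<open>Orthogonality to the vector \<open>T x\<close> is literally the vanishing, at
    the point \<open>x\<close>, of the derivative along the transposed field.\<close>
  have "(\<Sum>v\<in>W. c v * T x v) = 0" for x
    unfolding c_def by (rule ws) (auto simp: S_def intro!: range_eqI[of _ _ "[(1, x)]"])
  moreover have "word_monomial u x = (\<Sum>v\<in>W. c v * word_monomial v x)
       + (\<Sum>(a, w)\<leftarrow>ws. a * (real (length u) * (w \<bullet> x) ^ (length u - 1) * ((transpose A *v w) \<bullet> x)))" for x
  proof -
    have "(\<Sum>(a, w)\<leftarrow>ws. a * (real (length u) * (w \<bullet> x) ^ (length u - 1) * ((transpose A *v w) \<bullet> x)))
      = (\<Sum>v\<in>W. (\<Sum>(a, w)\<leftarrow>ws. a * T w v) * word_monomial v x)"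
      unfolding inner_power_word_derivative W_def T_def
      by (induction ws) (auto simp: algebra_simps sum.distrib sum_distrib_left)
    moreover have "word_monomial u x = (\<Sum>v\<in>W. (if v = u then 1 else 0) * word_monomial v x)"
      using finite_words[of "length u"] by (simp add: W_def if_distrib[of "\<lambda>z. z * _"] cong: if_cong)
        (subst sum.delta; simp)
    ultimately show ?thesis by (simp add: c_def algebra_simps sum_subtractf)
  qed
  ultimately show ?thesis using that unfolding W_def T_def by blast
qed

section \<open>The matrix exponential\<close>

text \<open>Components are exposed as real power series in \<open>t\<close>, so that they can be
  differentiated termwise. Convergence follows by comparing entries with the exponential series of
  \<open>\<bar>t\<bar> * K\<close>, where \<open>K\<close> is an operator bound for
  \<open>M\<close>.\<close>

lemma mat_exp_vec_sums:
  fixes M :: "real ^ 'k ^ 'k::finite"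
  shows "(\<lambda>j. (((\<lambda>y. M *v y) ^^ j) x $ i / fact j) * t ^ j) sums ((mat_exp (t *\<^sub>R M) *v x) $ i)"
proof -
  define P where "P = (\<lambda>j. ((**) M ^^ j) (mat 1))"
  obtain K where K: "\<And>y. norm (M *v y) \<le> norm y * K"
    using bounded_linear.bounded[OF matrix_vector_mul_bounded_linear[of M]] by blast
  \<comment> \<open>The bound is tested on a unit vector.\<close>
  have K0: "K \<ge> 0"
    using K[of "axis undefined 1"] norm_ge_zero[of "M *v axis undefined 1"] by (simp add: norm_axis_1 del: norm_ge_zero)
  have pow: "P j *v y = ((\<lambda>y. M *v y) ^^ j) y" for j y
    by (induction j) (simp_all add: P_def flip: matrix_vector_mul_assoc)
  have pow_bound: "norm (P j *v y) \<le> K ^ j * norm y" for j y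
  proof (induction j)
    case (Suc j)
    have "norm (P (Suc j) *v y) \<le> norm (P j *v y) * K"
      using K by (simp add: pow)
    also have "\<dots> \<le> (K ^ j * norm y) * K" using Suc K0 by (rule mult_right_mono)
    finally show ?case by (simp add: mult_ac)
  qed (simp add: P_def)
  have P_entry: "\<bar>P j $ a $ b\<bar> \<le> K ^ j" for j a b
  proof -
    have "P j $ a $ b = (P j *v axis b 1) $ a" by (simp add: matrix_vector_mult_basis column_def)
    also have "\<bar>\<dots>\<bar> \<le> K ^ j" using pow_bound[of j "axis b 1"] component_le_norm_cart[of "P j *v axis b 1" a]
      by (simp add: norm_axis_1)
    finally show ?thesis .
  qed
  have scale: "((**) (t *\<^sub>R M) ^^ j) (mat 1) = t ^ j *\<^sub>R P j" for j
  proof (induction j)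
    case (Suc j)
    have "((**) (t *\<^sub>R M) ^^ Suc j) (mat 1) = (t *\<^sub>R M) ** (t ^ j *\<^sub>R P j)" using Suc by simp
    also have "\<dots> = t ^ Suc j *\<^sub>R (M ** P j)"
      by (simp add: vec_eq_iff matrix_matrix_mult_def sum_distrib_left mult_ac)
    finally show ?case by (simp add: P_def)
  qed (simp add: P_def)
  define E where "E = (\<lambda>j. (1 / fact j) *\<^sub>R (t ^ j *\<^sub>R P j))"
  have "summable (\<lambda>j. E j $ a $ b)" for a b
  proof (rule summable_comparison_test)
    show "summable (\<lambda>j. inverse (fact j) * (\<bar>t\<bar> * K) ^ j)" using summable_exp[of "\<bar>t\<bar> * K"] by simp
    show "\<exists>N. \<forall>n\<ge>N. norm (E n $ a $ b) \<le> inverse (fact n) * (\<bar>t\<bar> * K) ^ n"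
      by (auto simp: E_def abs_mult power_mult_distrib divide_inverse power_abs mult.assoc intro!: mult_left_mono P_entry)
  qed
  then have "(\<lambda>j. E j $ a $ b) sums (\<Sum>j. E j $ a $ b)" for a b by (rule summable_sums)
  then have "E sums (\<chi> a b. \<Sum>j. E j $ a $ b)"
    unfolding sums_def by (intro vec_tendstoI) simp
  moreover have "mat_exp (t *\<^sub>R M) = (\<Sum>j. E j)" by (simp add: mat_exp_def scale E_def)
  ultimately have "E sums mat_exp (t *\<^sub>R M)" by (simp add: sums_iff)
  moreover have "bounded_linear (\<lambda>B :: real ^ 'k ^ 'k. (B *v x) $ i)"
    by (intro linear_conv_bounded_linear[THEN iffD1] linearI)
      (simp_all add: matrix_vector_mult_add_rdistrib scaleR_matrix_vector_assoc[symmetric])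
  ultimately have "(\<lambda>j. (E j *v x) $ i) sums ((mat_exp (t *\<^sub>R M) *v x) $ i)"
    by (rule bounded_linear.sums[rotated])
  moreover have "(E j *v x) $ i = (((\<lambda>y. M *v y) ^^ j) x $ i / fact j) * t ^ j" for j
    by (simp add: E_def scaleR_matrix_vector_assoc[symmetric] pow)
  ultimately show ?thesis by simp
qed

lemma mat_exp_zero_vec: "mat_exp (0 *\<^sub>R M) *v x = x" for M :: "real ^ 'k ^ 'k::finite"
proof (rule vec_eq_iff[THEN iffD2], rule allI)
  fix i
  have "(\<lambda>j. (((\<lambda>y. M *v y) ^^ j) x $ i / fact j) * 0 ^ j) sums (((\<lambda>y. M *v y) ^^ 0) x $ i / fact 0)"
    by (rule powser_sums_zero)
  from sums_unique2[OF mat_exp_vec_sums this]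
  show "(mat_exp (0 *\<^sub>R M) *v x) $ i = x $ i" by simp
qed

lemma mat_exp_has_vector_derivative:
  fixes M :: "real ^ 'k ^ 'k::finite"
  shows "((\<lambda>t. mat_exp (t *\<^sub>R M) *v x) has_vector_derivative M *v (mat_exp (t *\<^sub>R M) *v x)) (at t)"
proof -
  define c where "c = (\<lambda>x i j. ((\<lambda>y. M *v y) ^^ j) x $ i / fact j :: real)"
  have s: "(\<lambda>j. c x i j * t ^ j) sums ((mat_exp (t *\<^sub>R M) *v x) $ i)" for x i t
    unfolding c_def by (rule mat_exp_vec_sums)
  have "((\<lambda>t. (mat_exp (t *\<^sub>R M) *v x) $ i) has_real_derivative (mat_exp (t *\<^sub>R M) *v (M *v x)) $ i) (at t)" for i t
  proof -
    \<comment> \<open>Termwise differentiation shifts the coefficients, which amounts to replacing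
      \<open>x\<close> by \<open>M *v x\<close>.\<close>
    have "diffs (c x i) = c (M *v x) i"
      by (auto simp: fun_eq_iff diffs_def c_def funpow_swap1 divide_simps simp flip: of_nat_Suc)
    moreover have "((\<lambda>t. \<Sum>j. c x i j * t ^ j) has_real_derivative (\<Sum>j. diffs (c x i) j * t ^ j)) (at t)"
      using s sums_summable by (intro termdiffs_strong_converges_everywhere) blast
    ultimately show ?thesis using s by (simp add: sums_iff)
  qed
  then have "((\<lambda>t. mat_exp (t *\<^sub>R M) *v x) has_vector_derivative mat_exp (t *\<^sub>R M) *v (M *v x)) (at t)"
    unfolding has_vector_derivative_def has_field_derivative_def
    by (subst has_derivative_componentwise_within)
      (auto simp: Basis_vec_def inner_axis mult_commute_abs)
  moreover have "mat_exp (t *\<^sub>R M) *v (M *v x) = M *v (mat_exp (t *\<^sub>R M) *v x)"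
  proof (rule vec_eq_iff[THEN iffD2], rule allI)
    fix i
    have "(\<lambda>j. \<Sum>a\<in>UNIV. M $ i $ a * (c x a j * t ^ j)) sums (\<Sum>a\<in>UNIV. M $ i $ a * (mat_exp (t *\<^sub>R M) *v x) $ a)"
      by (intro sums_sum sums_mult s)
    moreover have "(\<Sum>a\<in>UNIV. M $ i $ a * (c x a j * t ^ j)) = c (M *v x) i j * t ^ j" for j
    proof -
      have "((\<lambda>y. M *v y) ^^ j) (M *v x) $ i = (\<Sum>a\<in>UNIV. M $ i $ a * ((\<lambda>y. M *v y) ^^ j) x $ a)"
        using funpow_swap1[of "\<lambda>y. M *v y" j x, symmetric] by (simp add: matrix_vector_mult_def[of M "_ x"])
      then show ?thesis by (simp add: c_def sum_distrib_left sum_distrib_right sum_divide_distrib mult_ac)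
    qed
    ultimately show "(mat_exp (t *\<^sub>R M) *v (M *v x)) $ i = (M *v (mat_exp (t *\<^sub>R M) *v x)) $ i"
      using s[where x="M *v x" and i=i and t=t] by (simp add: matrix_vector_mult_def[of M] sums_unique2)
  qed
  ultimately show ?thesis by simp
qed

text \<open>By the chain rule the derivative of \<open>N\<close> along an orbit \<open>y\<close> of
  the linear flow is \<open>N' y (M *v y)\<close>, which is 0.\<close>

lemma mat_exp_invariant:
  fixes M :: "real ^ 'k ^ 'k::finite" and N :: "real ^ 'k \<Rightarrow> real"
  assumes "\<And>x. (N has_derivative N' x) (at x)" "\<And>x. N' x (M *v x) = 0"
  shows "N (mat_exp (t *\<^sub>R M) *v x) = N x"
proof -
  define y where "y = (\<lambda>t. mat_exp (t *\<^sub>R M) *v x)"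
  have "((\<lambda>t. N (y t)) has_real_derivative 0) (at t)" for t
  proof -
    have "(y has_derivative (\<lambda>h. h *\<^sub>R (M *v y t))) (at t)"
      using mat_exp_has_vector_derivative[of M x t] by (simp add: has_vector_derivative_def y_def)
    from has_derivative_compose[OF this assms(1)] show ?thesis
      using assms(2) linear_scale[OF has_derivative_linear[OF assms(1)]]
      by (simp add: has_field_derivative_def lambda_zero)
  qed
  then have "N (y t) = N (y 0)" by (intro DERIV_isconst_all) auto
  then show ?thesis by (simp add: y_def mat_exp_zero_vec[of M x, simplified])
qed

section \<open>Weighted order of polynomials\<close>

text \<open>
  With weight 1 for \<open>x\<close> and 2 for \<open>\<epsilon>\<close>, the Hamiltonian agrees with its quadratic part \<open>H\<^sub>2(x)\<close>
  up to terms of weight at least 3.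
\<close>

inductive weighted_order :: "nat \<Rightarrow> ((real ^ 'k) \<times> (real ^ 'm) \<Rightarrow> real) \<Rightarrow> bool" for k where
  zero: "weighted_order k (\<lambda>z. 0)"
| add_monomial: "weighted_order k f \<Longrightarrow> k \<le> length u + 2 * length v \<Longrightarrow>
    weighted_order k (\<lambda>z. f z + c * (word_monomial u (fst z) * word_monomial v (snd z)))"

lemma weighted_order_mono: "weighted_order k f \<Longrightarrow> l \<le> k \<Longrightarrow> weighted_order l f"
  by (induction rule: weighted_order.induct) (auto intro: weighted_order.intros)

lemma weighted_order_monomial:
  "k \<le> length u + 2 * length v \<Longrightarrow>
    weighted_order k (\<lambda>z. c * (word_monomial u (fst z) * word_monomial v (snd z)))"
  using weighted_order.add_monomial[OF weighted_order.zero, of k u v c] by simp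

lemma weighted_order_add:
  assumes "weighted_order k f" "weighted_order k g"
  shows "weighted_order k (\<lambda>z. f z + g z)"
  using assms(2,1)
proof (induction rule: weighted_order.induct)
  case (add_monomial g u v c)
  then have "weighted_order k (\<lambda>z. (f z + g z) + c * (word_monomial u (fst z) * word_monomial v (snd z)))"
    by (intro weighted_order.add_monomial) auto
  then show ?case by (simp add: add.assoc)
qed simp

lemma weighted_order_mult:
  assumes "weighted_order k f" "weighted_order l g"
  shows "weighted_order (k + l) (\<lambda>z. f z * g z)"
  using assms(2)
proof (induction rule: weighted_order.induct)
  case zero
  then show ?case by (simp add: weighted_order.zero)
next
  case (add_monomial g u v c)
  have "weighted_order (k + l) (\<lambda>z. f z * (c * (word_monomial u (fst z) * word_monomial v (snd z))))"
    using assms(1)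
  proof (induction rule: weighted_order.induct)
    case zero
    then show ?case by (simp add: weighted_order.zero)
  next
    case (add_monomial f u' v' c')
    have "weighted_order (k + l) (\<lambda>z. f z * (c * (word_monomial u (fst z) * word_monomial v (snd z)))
      + (c' * c) * (word_monomial (u' @ u) (fst z) * word_monomial (v' @ v) (snd z)))"
      using add_monomial \<open>l \<le> length u + 2 * length v\<close> by (intro weighted_order.add_monomial) auto
    then show ?case by (simp add: word_monomial_append algebra_simps)
  qed
  with add_monomial show ?case
    using weighted_order_add by (auto simp: distrib_left)
qed

lemma weighted_order_const: "weighted_order 0 (\<lambda>z. c)"
  using weighted_order_monomial[of 0 "[]" "[]" c] by simp

lemma weighted_order_cmult: "weighted_order k f \<Longrightarrow> weighted_order k (\<lambda>z. c * f z)"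
  using weighted_order_mult[OF weighted_order_const[of c], of k f] by simp

lemma weighted_order_sum:
  "(\<And>i. i \<in> I \<Longrightarrow> weighted_order k (f i)) \<Longrightarrow> weighted_order k (\<lambda>z. \<Sum>i\<in>I. f i z)"
  by (induction I rule: infinite_finite_induct) (auto intro: weighted_order.zero weighted_order_add)

lemma weighted_order_power: "weighted_order k f \<Longrightarrow> weighted_order (n * k) (\<lambda>z. f z ^ n)"
  by (induction n) (auto intro: weighted_order_const weighted_order_mult)

lemma weighted_order_fst_nth: "weighted_order 1 (\<lambda>z. fst z $ a)"
  using weighted_order_monomial[of 1 "[a]" "[]" 1] by simp

lemma weighted_order_snd_nth: "weighted_order 2 (\<lambda>z. snd z $ a)"
  using weighted_order_monomial[of 2 "[]" "[a]" 1] by simp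

lemma weighted_order_inner: "weighted_order 1 (\<lambda>z. w \<bullet> fst z)" for w :: "real ^ 'k::finite"
  unfolding inner_vec_def inner_real_def
  by (intro weighted_order_sum weighted_order_cmult weighted_order_fst_nth)

text \<open>Exchanging one factor \<open>x $ a\<close> of weight 1 for \<open>\<delta> z $ a\<close>
  of weight \<open>d + 1\<close> gains \<open>d\<close>, and the difference of shifted and unshifted
  products telescopes into such exchanges.\<close>

lemma weighted_order_shift:
  fixes f :: "(real ^ 'k) \<times> (real ^ 'm) \<Rightarrow> real"
  assumes \<delta>: "\<And>a. weighted_order (Suc d) (\<lambda>z. \<delta> z $ a)"
    and f: "weighted_order k f"
  shows "weighted_order (k + d) (\<lambda>z. f (fst z + \<delta> z, snd z) - f z)"
  using f
proof (induction rule: weighted_order.induct)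
  case zero
  then show ?case by (simp add: weighted_order.zero)
next
  case (add_monomial f u v c)
  have word: "weighted_order (length u + d) (\<lambda>z. word_monomial u (fst z + \<delta> z) - word_monomial u (fst z))" for u
  proof (induction u)
    case Nil
    then show ?case by (simp add: weighted_order.zero)
  next
    case (Cons a u)
    have mon: "weighted_order (length u) (\<lambda>z. word_monomial u (fst z))"
      using weighted_order_monomial[of "length u" u "[]" 1] by simp
    \<comment> \<open>The induction hypothesis also bounds the shifted word itself: it is the
      unshifted one plus a difference of no smaller weight.\<close>
    have shifted: "weighted_order (length u) (\<lambda>z. word_monomial u (fst z + \<delta> z))"
      using weighted_order_add[OF weighted_order_mono[OF Cons.IH, of "length u"] mon] by simp
    have "weighted_order (length (a # u) + d) (\<lambda>z. \<delta> z $ a * word_monomial u (fst z + \<delta> z)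
       + fst z $ a * (word_monomial u (fst z + \<delta> z) - word_monomial u (fst z)))"
      using weighted_order_mult[OF \<delta>[of a] shifted] weighted_order_mult[OF weighted_order_fst_nth[of a] Cons.IH]
      by (intro weighted_order_add) (simp_all add: add_ac)
    then show ?case by (simp add: algebra_simps)
  qed
  have "weighted_order ((length u + d) + 2 * length v)
      (\<lambda>z. (word_monomial u (fst z + \<delta> z) - word_monomial u (fst z)) * (c * word_monomial v (snd z)))"
    using weighted_order_monomial[of "2 * length v" "[]" v c] by (intro weighted_order_mult word) simp
  then have "weighted_order (k + d)
      (\<lambda>z. (word_monomial u (fst z + \<delta> z) - word_monomial u (fst z)) * (c * word_monomial v (snd z)))"
    using add_monomial.hyps by (elim weighted_order_mono) simp
  from weighted_order_add[OF add_monomial.IH this] show ?case by (simp add: algebra_simps)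
qed

text \<open>The radius 1 is fixed in advance: on the unit ball higher powers of the norm are
  dominated by lower ones, so polynomial terms can share one radius.\<close>

definition small_order :: "nat \<Rightarrow> ('a::real_normed_vector \<Rightarrow> real) \<Rightarrow> bool" where
  "small_order d f \<longleftrightarrow> (\<exists>C. \<forall>z. norm z \<le> 1 \<longrightarrow> \<bar>f z\<bar> \<le> C * norm z ^ d)"

lemma small_order_add:
  assumes "small_order d f" "small_order d g"
  shows "small_order d (\<lambda>z. f z + g z)"
proof -
  obtain C C' where "\<And>z. norm z \<le> 1 \<Longrightarrow> \<bar>f z\<bar> \<le> C * norm z ^ d" "\<And>z. norm z \<le> 1 \<Longrightarrow> \<bar>g z\<bar> \<le> C' * norm z ^ d"
    using assms by (auto simp: small_order_def)
  then have "\<bar>f z + g z\<bar> \<le> (C + C') * norm z ^ d" if "norm z \<le> 1" for z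
    using abs_triangle_ineq[of "f z" "g z"] that by (fastforce simp: distrib_right)
  then show ?thesis unfolding small_order_def by blast
qed

lemma small_order_zero: "small_order d (\<lambda>z. 0)"
  by (auto simp: small_order_def intro: exI[of _ 0])

lemma abs_word_monomial_le: "\<bar>word_monomial u x\<bar> \<le> norm x ^ length u" for x :: "real ^ 'k::finite"
  by (induction u) (auto simp: abs_mult intro!: mult_mono component_le_norm_cart)

lemma small_order_monomial:
  fixes u :: "'k::finite list" and v :: "'m::finite list"
  assumes "d \<le> length u + length v"
  shows "small_order d (\<lambda>z. c * (word_monomial u (fst z) * word_monomial v (snd z)))"
proof -
  have "\<bar>c * (word_monomial u (fst z) * word_monomial v (snd z))\<bar> \<le> \<bar>c\<bar> * norm z ^ d"
    if "norm z \<le> 1" for z :: "(real ^ 'k) \<times> (real ^ 'm)"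
  proof -
    have "\<bar>word_monomial u (fst z)\<bar> \<le> norm z ^ length u"
      by (rule order_trans[OF abs_word_monomial_le]) (auto intro: power_mono norm_fst_le[of "fst z" "snd z", simplified])
    moreover have "\<bar>word_monomial v (snd z)\<bar> \<le> norm z ^ length v"
      by (rule order_trans[OF abs_word_monomial_le]) (auto intro: power_mono norm_snd_le[of "snd z" "fst z", simplified])
    ultimately have "\<bar>word_monomial u (fst z)\<bar> * \<bar>word_monomial v (snd z)\<bar> \<le> norm z ^ (length u + length v)"
      unfolding power_add by (intro mult_mono) auto
    also have "\<dots> \<le> norm z ^ d" using that assms by (intro power_decreasing) auto
    finally show ?thesis by (simp add: abs_mult mult_left_mono)
  qed
  then show ?thesis unfolding small_order_def by blast
qed

text \<open>Twice the degree of a monomial is at least its weight, hence at least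
  \<open>2 * d - 1\<close>; by integrality the degree is at least \<open>d\<close>.\<close>

lemma weighted_order_imp_small_order:
  assumes "weighted_order k f" "2 * d \<le> Suc k"
  shows "small_order d f"
  using assms(1)
proof (induction rule: weighted_order.induct)
  case zero
  then show ?case by (rule small_order_zero)
next
  case (add_monomial f u v c)
  then show ?case using assms(2) by (intro small_order_add small_order_monomial) auto
qed

section \<open>Polynomials of bounded degree\<close>

lemma polynomial_degree_le_add:
  assumes "polynomial_degree_le d f" "polynomial_degree_le d g"
  shows "polynomial_degree_le d (\<lambda>z. f z + g z)"
proof -
  obtain c c' where "\<And>z. f z = (\<Sum>\<alpha> | \<alpha> \<in> Basis \<rightarrow>\<^sub>E {..d} \<and> (\<Sum>b\<in>Basis. \<alpha> b) \<le> d. c \<alpha> * (\<Prod>b\<in>Basis. (z \<bullet> b) ^ \<alpha> b))"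
    "\<And>z. g z = (\<Sum>\<alpha> | \<alpha> \<in> Basis \<rightarrow>\<^sub>E {..d} \<and> (\<Sum>b\<in>Basis. \<alpha> b) \<le> d. c' \<alpha> * (\<Prod>b\<in>Basis. (z \<bullet> b) ^ \<alpha> b))"
    using assms unfolding polynomial_degree_le_def by blast
  then show ?thesis unfolding polynomial_degree_le_def
    by (intro exI[of _ "\<lambda>\<alpha>. c \<alpha> + c' \<alpha>"]) (simp add: distrib_right sum.distrib)
qed

lemma polynomial_degree_le_zero: "polynomial_degree_le d (\<lambda>z. 0)"
  unfolding polynomial_degree_le_def by (intro exI[of _ "\<lambda>_. 0"]) simp

lemma polynomial_degree_le_sum:
  "(\<And>i. i \<in> I \<Longrightarrow> polynomial_degree_le d (f i)) \<Longrightarrow> polynomial_degree_le d (\<lambda>z. \<Sum>i\<in>I. f i z)"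
  by (induction I rule: infinite_finite_induct) (auto intro: polynomial_degree_le_zero polynomial_degree_le_add)

text \<open>The product is a single term of the multi-index sum, the exponents being the
  multiplicities in the list.\<close>

lemma polynomial_degree_le_prod_list:
  fixes bs :: "'a::euclidean_space list"
  assumes "set bs \<subseteq> Basis" "length bs \<le> d"
  shows "polynomial_degree_le d (\<lambda>z. a * (\<Prod>b\<leftarrow>bs. z \<bullet> b))"
proof -
  \<comment> \<open>The restriction makes the multi-index extensional, as membership in the
    dependent product over \<open>Basis\<close> demands.\<close>
  define \<beta> where "\<beta> = restrict (count_list bs) Basis"
  have len: "(\<Sum>b\<in>Basis. \<beta> b) = length bs"
    using sum_count_set[OF assms(1) finite_Basis] by (simp add: \<beta>_def)
  have "\<beta> b \<le> d" if "b \<in> Basis" for b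
    using member_le_sum[OF that, of \<beta>] len assms(2) by simp
  then have \<beta>: "\<beta> \<in> Basis \<rightarrow>\<^sub>E {..d}" by (auto simp: \<beta>_def)
  have fin: "finite {\<alpha>. \<alpha> \<in> (Basis :: 'a set) \<rightarrow>\<^sub>E {..d} \<and> (\<Sum>b\<in>Basis. \<alpha> b) \<le> d}"
    by (rule finite_subset[OF _ finite_PiE[of "Basis :: 'a set" "\<lambda>_. {..d}"]]) auto
  have "(\<Prod>b\<leftarrow>bs. z \<bullet> b) = (\<Prod>b\<in>Basis. (z \<bullet> b) ^ \<beta> b)" for z
  proof -
    have "(\<Prod>b\<leftarrow>bs. z \<bullet> b) = (\<Prod>b\<in>Basis. (z \<bullet> b) ^ count_list bs b)"
      using assms(1)
    proof (induction bs)
      case (Cons c bs)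
      have "(\<Prod>b\<in>Basis. (z \<bullet> b) ^ count_list (c # bs) b)
         = (\<Prod>b\<in>Basis. (if b = c then z \<bullet> b else 1) * (z \<bullet> b) ^ count_list bs b)"
        by (rule prod.cong) auto
      also have "\<dots> = (z \<bullet> c) * (\<Prod>b\<in>Basis. (z \<bullet> b) ^ count_list bs b)"
        using Cons.prems by (simp add: prod.distrib)
      finally show ?case using Cons by simp
    qed simp
    then show ?thesis by (simp add: \<beta>_def)
  qed
  then show ?thesis
    unfolding polynomial_degree_le_def
    using \<beta> fin len assms(2)
    by (intro exI[of _ "\<lambda>\<alpha>. if \<alpha> = \<beta> then a else 0"])
      (simp add: if_distrib[of "\<lambda>y. y * _"] cong: if_cong)
qed

lemma polynomial_degree_le_monomial:
  fixes u :: "'k::finite list" and v :: "'m::finite list"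
  assumes "length u + length v \<le> d"
  shows "polynomial_degree_le d (\<lambda>z. c * (word_monomial u (fst z) * word_monomial v (snd z)))"
proof -
  define bs :: "((real ^ 'k) \<times> (real ^ 'm)) list"
    where "bs = map (\<lambda>a. (axis a 1, 0)) u @ map (\<lambda>a. (0, axis a 1)) v"
  have "set bs \<subseteq> Basis" by (auto simp: bs_def Basis_prod_def Basis_vec_def)
  then have "polynomial_degree_le d (\<lambda>z. c * (\<Prod>b\<leftarrow>bs. z \<bullet> b))"
    using assms by (intro polynomial_degree_le_prod_list) (auto simp: bs_def)
  moreover have "(\<Prod>b\<leftarrow>bs. z \<bullet> b) = word_monomial u (fst z) * word_monomial v (snd z)" for z
    by (simp add: bs_def word_monomial_def inner_prod_def inner_axis o_def)
  ultimately show ?thesis by simp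
qed

section \<open>Symplectic shears\<close>

text \<open>The orientation is such that Hamilton's equations read x' = \<J> grad H and the
  symplectic form on the first n degrees of freedom is \<open>x \<bullet> \<J> y\<close>.\<close>

definition symplectic_matrix_vec :: "real ^ ('n::finite + 'n) \<Rightarrow> real ^ ('n + 'n)" (\<open>\<J>\<close>) where
  "\<J> y = (\<chi> k. case k of Inl i \<Rightarrow> y $ Inr i | Inr i \<Rightarrow> - y $ Inl i)"

lemma \<J>_nth [simp]: "\<J> y $ Inl i = y $ Inr i" "\<J> y $ Inr i = - y $ Inl i"
  by (simp_all add: symplectic_matrix_vec_def)

lemma sum_UNIV_sum_type: "(\<Sum>k\<in>UNIV. f k) = (\<Sum>i\<in>UNIV. f (Inl i)) + (\<Sum>i\<in>UNIV. f (Inr i))"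
  for f :: "'a::finite + 'b::finite \<Rightarrow> 'c::comm_monoid_add"
  by (simp add: sum.Plus flip: UNIV_Plus_UNIV)

lemma \<J>_skew: "\<J> x \<bullet> y = - (x \<bullet> \<J> y)"
  by (simp add: inner_vec_def sum_UNIV_sum_type sum_negf)

lemma \<J>_\<J>: "\<J> (\<J> x) = - x"
  by (simp add: vec_eq_iff symplectic_matrix_vec_def split: sum.split)

lemma inner_\<J>_self: "x \<bullet> \<J> x = 0" "\<J> x \<bullet> x = 0"
  using \<J>_skew[of x x] by (simp_all add: inner_commute)

lemma inner_\<J>_\<J>: "\<J> x \<bullet> \<J> y = x \<bullet> y"
  by (simp add: \<J>_skew \<J>_\<J>)

lemma linear_\<J>: "linear \<J>"
  by (rule linearI) (simp_all add: vec_eq_iff symplectic_matrix_vec_def split: sum.split)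

lemma symplectic_form_eq:
  "symplectic_form (x, q, p) (x', q', p') = (q * p' - p * q') + x \<bullet> \<J> x'"
  by (simp add: inner_vec_def sum_UNIV_sum_type sum_negf sum_subtractf)

text \<open>\<open>\<phi> \<epsilon>\<close> maps the old variables \<open>(q, p)\<close> to the new ones and \<open>\<psi> \<epsilon>\<close> is its inverse.\<close>

definition canonical_pair ::
    "(real ^ 'm::finite \<Rightarrow> real ^ ('n::finite + 'n) \<Rightarrow> real ^ ('n + 'n)) \<Rightarrow>
     (real ^ 'm \<Rightarrow> real ^ ('n + 'n) \<Rightarrow> real ^ ('n + 'n)) \<Rightarrow> bool" where
  "canonical_pair \<phi> \<psi> \<longleftrightarrow>
     polynomial_function (\<lambda>z. \<phi> (snd z) (fst z)) \<and> polynomial_function (\<lambda>z. \<psi> (snd z) (fst z)) \<and>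
     (\<forall>\<epsilon> x. \<psi> \<epsilon> (\<phi> \<epsilon> x) = x \<and> \<phi> \<epsilon> (\<psi> \<epsilon> x) = x) \<and>
     (\<forall>\<epsilon> x. \<exists>D. (\<phi> \<epsilon> has_derivative D) (at x) \<and> (\<forall>a b. D a \<bullet> \<J> (D b) = a \<bullet> \<J> b)) \<and>
     \<phi> 0 0 = 0 \<and> (\<phi> 0 has_derivative (\<lambda>v. v)) (at 0)"

lemma polynomial_function_Pair:
  fixes f :: "'a::real_normed_vector \<Rightarrow> 'b::euclidean_space" and g :: "'a \<Rightarrow> 'c::euclidean_space"
  assumes "polynomial_function f" "polynomial_function g"
  shows "polynomial_function (\<lambda>x. (f x, g x))"
  unfolding polynomial_function_iff_Basis_inner[of "\<lambda>x. (f x, g x)"] inner_prod_def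
  using assms by (auto simp: real_polynomial_function_eq intro!: polynomial_function_add polynomial_function_inner)

lemma canonical_pair_id: "canonical_pair (\<lambda>\<epsilon> x. x) (\<lambda>\<epsilon> x. x)"
  unfolding canonical_pair_def
  by (auto intro!: polynomial_function_bounded_linear bounded_linear_fst exI[of _ "\<lambda>v. v"])

lemma canonical_pair_compose:
  fixes \<phi>\<^sub>1 \<psi>\<^sub>1 \<phi>\<^sub>2 \<psi>\<^sub>2 :: "real ^ 'm::finite \<Rightarrow> real ^ ('n::finite + 'n) \<Rightarrow> real ^ ('n + 'n)"
  assumes "canonical_pair \<phi>\<^sub>1 \<psi>\<^sub>1" "canonical_pair \<phi>\<^sub>2 \<psi>\<^sub>2"
  shows "canonical_pair (\<lambda>\<epsilon> x. \<phi>\<^sub>2 \<epsilon> (\<phi>\<^sub>1 \<epsilon> x)) (\<lambda>\<epsilon> x. \<psi>\<^sub>1 \<epsilon> (\<psi>\<^sub>2 \<epsilon> x))"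
proof -
  have comp: "polynomial_function (\<lambda>z. f (snd z) (g (snd z) (fst z)))"
    if "polynomial_function (\<lambda>z. f (snd z) (fst z))" "polynomial_function (\<lambda>z. g (snd z) (fst z))"
    for f g :: "real ^ 'm \<Rightarrow> real ^ ('n + 'n) \<Rightarrow> real ^ ('n + 'n)"
  proof -
    have "polynomial_function (\<lambda>z. (g (snd z) (fst z), snd z))"
      by (intro polynomial_function_Pair that(2) polynomial_function_bounded_linear bounded_linear_snd)
    from polynomial_function_compose[OF this that(1)] show ?thesis by (simp add: o_def)
  qed
  have "\<exists>D. ((\<lambda>x. \<phi>\<^sub>2 \<epsilon> (\<phi>\<^sub>1 \<epsilon> x)) has_derivative D) (at x) \<and> (\<forall>a b. D a \<bullet> \<J> (D b) = a \<bullet> \<J> b)" for \<epsilon> x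
  proof -
    obtain D\<^sub>1 where D1: "(\<phi>\<^sub>1 \<epsilon> has_derivative D\<^sub>1) (at x)" "\<forall>a b. D\<^sub>1 a \<bullet> \<J> (D\<^sub>1 b) = a \<bullet> \<J> b"
      using assms(1) unfolding canonical_pair_def by blast
    obtain D\<^sub>2 where D2: "(\<phi>\<^sub>2 \<epsilon> has_derivative D\<^sub>2) (at (\<phi>\<^sub>1 \<epsilon> x))" "\<forall>a b. D\<^sub>2 a \<bullet> \<J> (D\<^sub>2 b) = a \<bullet> \<J> b"
      using assms(2) unfolding canonical_pair_def by blast
    show ?thesis using has_derivative_compose[OF D1(1) D2(1)] D1(2) D2(2)
      by (intro exI[of _ "\<lambda>v. D\<^sub>2 (D\<^sub>1 v)"]) simp
  qed
  moreover have "((\<lambda>x. \<phi>\<^sub>2 0 (\<phi>\<^sub>1 0 x)) has_derivative (\<lambda>v. v)) (at 0)"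
    using has_derivative_compose[of "\<phi>\<^sub>1 0" "\<lambda>v. v" 0 UNIV "\<phi>\<^sub>2 0" "\<lambda>v. v"] assms
    by (simp add: canonical_pair_def)
  moreover have "polynomial_function (\<lambda>z. \<phi>\<^sub>2 (snd z) (\<phi>\<^sub>1 (snd z) (fst z)))"
    "polynomial_function (\<lambda>z. \<psi>\<^sub>1 (snd z) (\<psi>\<^sub>2 (snd z) (fst z)))"
    using comp[of \<phi>\<^sub>2 \<phi>\<^sub>1] comp[of \<psi>\<^sub>1 \<psi>\<^sub>2] assms by (simp_all add: canonical_pair_def)
  ultimately show ?thesis
    using assms unfolding canonical_pair_def by simp
qed

text \<open>The time-one map of the Hamiltonian \<open>c \<epsilon>\<^sup>v (w \<bullet> x)\<^sup>i\<close>, whose flow conserves \<open>w \<bullet> x\<close>.\<close>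

definition shear_factor :: "real \<Rightarrow> 'm list \<Rightarrow> nat \<Rightarrow> real ^ 'k \<Rightarrow> real ^ 'm \<Rightarrow> real ^ 'k::finite \<Rightarrow> real" where
  "shear_factor c v i w \<epsilon> x = c * word_monomial v \<epsilon> * (real i * (w \<bullet> x) ^ (i - 1))"

definition shear :: "real \<Rightarrow> 'm list \<Rightarrow> nat \<Rightarrow> real ^ ('n + 'n) \<Rightarrow> real ^ 'm \<Rightarrow> real ^ ('n::finite + 'n) \<Rightarrow> real ^ ('n + 'n)" where
  "shear c v i w \<epsilon> x = x + shear_factor c v i w \<epsilon> x *\<^sub>R \<J> w"

text \<open>The displacement is along \<open>\<J> w\<close>, which is orthogonal to
  \<open>w\<close>, so \<open>w \<bullet> x\<close> is unchanged. Reversing the sign of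
  \<open>c\<close> therefore inverts a shear exactly.\<close>

lemma shear_factor_shear: "shear_factor c v i w \<epsilon> (shear c' v' i' w \<epsilon>' x) = shear_factor c v i w \<epsilon> x"
  by (simp add: shear_factor_def shear_def inner_add_right inner_\<J>_self)

lemma shear_inverse: "shear (- c) v i w \<epsilon> (shear c v i w \<epsilon> x) = x"
  unfolding shear_def[of "- c"] shear_factor_shear by (simp add: shear_def shear_factor_def)

lemma polynomial_function_shear:
  "polynomial_function (\<lambda>z. shear c v i w (snd z) (fst z))"
proof -
  have "real_polynomial_function (\<lambda>z. word_monomial v (snd z))"
  proof (induction v)
    case (Cons a v)
    have "bounded_linear (\<lambda>z. snd z $ a)"
      by (rule bounded_linear_compose[OF bounded_linear_vec_nth bounded_linear_snd])
    with Cons show ?case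
      unfolding word_monomial_simps
      by (intro real_polynomial_function.intros(4)[OF real_polynomial_function.intros(1)])
  qed (simp add: real_polynomial_function.intros(2))
  moreover have "real_polynomial_function (\<lambda>z. w \<bullet> fst z)"
    by (intro real_polynomial_function.intros(1) bounded_linear_compose[OF bounded_linear_inner_right bounded_linear_fst])
  ultimately have "real_polynomial_function (\<lambda>z. shear_factor c v i w (snd z) (fst z))"
    unfolding shear_factor_def
    by (intro real_polynomial_function.intros(4) real_polynomial_function.intros(2) real_polynomial_function_power)
  then show ?thesis
    unfolding shear_def real_polynomial_function_eq
    by (intro polynomial_function_add polynomial_function_mult polynomial_function_const
        polynomial_function_bounded_linear[OF bounded_linear_fst])
qed

lemma shear_has_derivative:
  "(shear c v i w \<epsilon> has_derivative
     (\<lambda>a. a + (c * word_monomial v \<epsilon> * (real i * (real (i - 1) * (w \<bullet> x) ^ (i - 1 - 1))) * (w \<bullet> a)) *\<^sub>R \<J> w)) (at x)"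
  unfolding shear_def shear_factor_def
  by (auto intro!: derivative_eq_intros simp: fun_eq_iff mult_ac)

text \<open>The derivative is the identity plus a rank-one map along \<open>\<J> w\<close>, a
  symplectic transvection. At the origin with \<epsilon> = 0 the displacement and its derivative
  vanish: either \<open>v\<close> is nonempty, or the weight bound gives
  \<open>3 \<le> i\<close>.\<close>

lemma canonical_pair_shear:
  fixes v :: "'m::finite list" and w :: "real ^ ('n::finite + 'n)"
  assumes "3 \<le> i + 2 * length v"
  shows "canonical_pair (shear (- c) v i w) (shear c v i w)"
proof -
  have zero: "c * word_monomial v 0 * (real i * (real (i - 1) * (w \<bullet> 0) ^ (i - 1 - 1))) = 0"
    "shear_factor c v i w 0 0 = 0" for c
    using assms by (cases v; force simp: shear_factor_def power_0_left)+
  have "\<exists>D. (shear (- c) v i w \<epsilon> has_derivative D) (at x) \<and> (\<forall>a b. D a \<bullet> \<J> (D b) = a \<bullet> \<J> b)" for \<epsilon> x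
  proof (intro exI conjI allI)
    show "(shear (- c) v i w \<epsilon> has_derivative
     (\<lambda>a. a + (- c * word_monomial v \<epsilon> * (real i * (real (i - 1) * (w \<bullet> x) ^ (i - 1 - 1))) * (w \<bullet> a)) *\<^sub>R \<J> w)) (at x)"
      by (rule shear_has_derivative)
    have sympl: "(a + (s * (w \<bullet> a)) *\<^sub>R \<J> w) \<bullet> \<J> (b + (s * (w \<bullet> b)) *\<^sub>R \<J> w) = a \<bullet> \<J> b" for s a b
      by (simp add: linear_add[OF linear_\<J>] linear_scale[OF linear_\<J>] \<J>_\<J> inner_add_left inner_add_right
          inner_diff_left inner_diff_right inner_\<J>_\<J> inner_\<J>_self inner_commute[of w])
    show "(a + (- c * word_monomial v \<epsilon> * (real i * (real (i - 1) * (w \<bullet> x) ^ (i - 1 - 1))) * (w \<bullet> a)) *\<^sub>R \<J> w) \<bullet>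
      \<J> (b + (- c * word_monomial v \<epsilon> * (real i * (real (i - 1) * (w \<bullet> x) ^ (i - 1 - 1))) * (w \<bullet> b)) *\<^sub>R \<J> w)
      = a \<bullet> \<J> b" for a b by (rule sympl)
  qed
  moreover have "shear (- c) v i w 0 0 = 0" by (simp add: shear_def zero)
  moreover have "(shear (- c) v i w 0 has_derivative (\<lambda>v. v)) (at 0)"
    using shear_has_derivative[of "- c" v i w 0 0] zero(1)[of "- c"] by (simp only:) simp
  ultimately show ?thesis
    using shear_inverse[of c v i w] shear_inverse[of "- c" v i w]
    unfolding canonical_pair_def by (simp add: polynomial_function_shear)
qed

section \<open>Effect of a shear on a Hamiltonian\<close>

definition quadratic_form :: "('k \<Rightarrow> 'k \<Rightarrow> real) \<Rightarrow> real ^ 'k::finite \<Rightarrow> real" where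
  "quadratic_form s x = (\<Sum>j\<in>UNIV. \<Sum>k\<in>UNIV. s j k * x $ j * x $ k)"

text \<open>The coefficients \<open>s\<close> may be asymmetric, hence the symmetrized sum in the
  gradient.\<close>

definition quadratic_gradient :: "('k \<Rightarrow> 'k \<Rightarrow> real) \<Rightarrow> real ^ 'k::finite \<Rightarrow> real ^ 'k" where
  "quadratic_gradient s x = (\<chi> j. \<Sum>k\<in>UNIV. (s j k + s k j) * x $ k)"

lemma quadratic_form_add:
  "quadratic_form s (x + y) = quadratic_form s x + quadratic_gradient s x \<bullet> y + quadratic_form s y"
proof -
  have "(\<Sum>j\<in>UNIV. \<Sum>k\<in>UNIV. s j k * x $ j * y $ k) = (\<Sum>j\<in>UNIV. \<Sum>k\<in>UNIV. s k j * x $ k * y $ j)"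
    by (rule sum.swap)
  then show ?thesis
    by (simp add: quadratic_form_def quadratic_gradient_def inner_vec_def algebra_simps
        sum.distrib sum_distrib_left)
qed

lemma quadratic_form_scaleR: "quadratic_form s (r *\<^sub>R x) = r\<^sup>2 * quadratic_form s x"
  by (simp add: quadratic_form_def power2_eq_square sum_distrib_left mult_ac)

lemma linear_quadratic_gradient: "linear (quadratic_gradient s)"
  by (rule linearI) (simp_all add: quadratic_gradient_def vec_eq_iff algebra_simps sum.distrib sum_distrib_left)

lemma quadratic_form_has_derivative:
  "(quadratic_form s has_derivative (\<lambda>y. quadratic_gradient s x \<bullet> y)) (at x)"
proof -
  have "(quadratic_form s has_derivative
      (\<lambda>y. \<Sum>j\<in>UNIV. \<Sum>k\<in>UNIV. s j k * x $ j * y $ k + s j k * y $ j * x $ k)) (at x)"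
    unfolding quadratic_form_def
    by (auto intro!: derivative_eq_intros bounded_linear_imp_has_derivative sum.cong simp: fun_eq_iff algebra_simps)
  moreover have "(\<Sum>j\<in>UNIV. \<Sum>k\<in>UNIV. s j k * x $ j * y $ k + s j k * y $ j * x $ k) = quadratic_gradient s x \<bullet> y" for y
    using sum.swap[of "\<lambda>j k. s j k * x $ j * y $ k" UNIV UNIV]
    by (simp add: quadratic_gradient_def inner_vec_def algebra_simps sum.distrib sum_distrib_left)
  ultimately show ?thesis by simp
qed

definition quadratic_field :: "('n + 'n \<Rightarrow> 'n + 'n \<Rightarrow> real) \<Rightarrow> real ^ ('n::finite + 'n) ^ ('n + 'n)" where
  "quadratic_field s = matrix (\<lambda>x. \<J> (quadratic_gradient s x))"

lemma quadratic_field_mult: "quadratic_field s *v x = \<J> (quadratic_gradient s x)"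
  unfolding quadratic_field_def
  using matrix_works[OF linear_compose[OF linear_quadratic_gradient linear_\<J>,
      folded linear_matrix_vector_mul_eq]]
  by (simp add: o_def)

lemma hamiltonian_vector_field_quadratic_form:
  "matrix (hamiltonian_vector_field (quadratic_form s)) = quadratic_field s"
proof -
  have "partial_derivative k (quadratic_form s) x = quadratic_gradient s x $ k" for k x
    unfolding partial_derivative_def
    by (simp add: frechet_derivative_at[OF quadratic_form_has_derivative, symmetric] inner_axis)
  then have "hamiltonian_vector_field (quadratic_form s) = (\<lambda>x. \<J> (quadratic_gradient s x))"
    by (simp add: fun_eq_iff hamiltonian_vector_field_def symplectic_matrix_vec_def split: sum.split)
  then show ?thesis by (simp add: quadratic_field_def)
qed

text \<open>Let k be the weight of the generator. The displacement has weight k - 1, so the terms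
  beyond the quadratic form change by weight 3 + (k - 2) = k + 1, and the term quadratic in the
  displacement has weight 2 (k - 1), which is at least k + 1 because k is at least 3. What is left
  is the first-order change of the quadratic form, which skewness of \<open>\<J>\<close> turns into
  a derivative along the linear field.\<close>

lemma shear_effect:
  fixes F :: "(real ^ ('n::finite + 'n)) \<times> (real ^ 'm::finite) \<Rightarrow> real"
  assumes "weighted_order 3 (\<lambda>z. F z - quadratic_form s (fst z))" "3 \<le> i + 2 * length v"
  shows "weighted_order (Suc (i + 2 * length v)) (\<lambda>z. F (shear c v i w (snd z) (fst z), snd z) - F z
     + c * word_monomial v (snd z) * (real i * (w \<bullet> fst z) ^ (i - 1) * ((transpose (quadratic_field s) *v w) \<bullet> fst z)))"
proof -
  define \<kappa> where "\<kappa> = (\<lambda>z. shear_factor c v i w (snd z) (fst z) :: real)"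
  have \<kappa>: "weighted_order (i + 2 * length v - 1) \<kappa>"
  proof (cases i)
    case 0
    then show ?thesis by (simp add: \<kappa>_def shear_factor_def weighted_order.zero)
  next
    case (Suc j)
    have "weighted_order (2 * length v + j * 1) (\<lambda>z. c * word_monomial v (snd z) * (real i * (w \<bullet> fst z) ^ j))"
      using weighted_order_mult[OF weighted_order_monomial[of "2 * length v" "[]" v c]
          weighted_order_cmult[OF weighted_order_power[OF weighted_order_inner]]] by simp
    then show ?thesis unfolding \<kappa>_def shear_factor_def using Suc by (simp add: add.commute)
  qed
  have "weighted_order (3 + (i + 2 * length v - 2)) (\<lambda>z.
     (F (fst z + \<kappa> z *\<^sub>R \<J> w, snd z) - quadratic_form s (fst (fst z + \<kappa> z *\<^sub>R \<J> w, snd z)))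
      - (F z - quadratic_form s (fst z)))"
  proof (rule weighted_order_shift[OF _ assms(1)])
    show "weighted_order (Suc (i + 2 * length v - 2)) (\<lambda>z. (\<kappa> z *\<^sub>R \<J> w) $ a)" for a
    proof -
      have "weighted_order (i + 2 * length v - 1) (\<lambda>z. \<J> w $ a * \<kappa> z)" by (rule weighted_order_cmult[OF \<kappa>])
      moreover have "Suc (i + 2 * length v - 2) = i + 2 * length v - 1" using assms(2) by simp
      ultimately show ?thesis by (simp add: mult.commute)
    qed
  qed
  moreover have "3 + (i + 2 * length v - 2) = Suc (i + 2 * length v)" using assms(2) by simp
  moreover have "weighted_order (Suc (i + 2 * length v)) (\<lambda>z. quadratic_form s (\<J> w) * (\<kappa> z * \<kappa> z))"
    using assms(2) by (intro weighted_order_cmult weighted_order_mono[OF weighted_order_mult[OF \<kappa> \<kappa>]]) simp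
  ultimately have "weighted_order (Suc (i + 2 * length v)) (\<lambda>z.
     ((F (fst z + \<kappa> z *\<^sub>R \<J> w, snd z) - quadratic_form s (fst z + \<kappa> z *\<^sub>R \<J> w))
      - (F z - quadratic_form s (fst z))) + quadratic_form s (\<J> w) * (\<kappa> z * \<kappa> z))"
    by (simp add: weighted_order_add)
  moreover have "quadratic_form s (x + r *\<^sub>R \<J> w) = quadratic_form s x
      - r * ((transpose (quadratic_field s) *v w) \<bullet> x) + quadratic_form s (\<J> w) * (r * r)" for x r
  proof -
    have "quadratic_gradient s x \<bullet> \<J> w = - (\<J> (quadratic_gradient s x) \<bullet> w)" by (simp add: \<J>_skew)
    also have "\<dots> = - ((transpose (quadratic_field s) *v w) \<bullet> x)"
      by (simp add: quadratic_field_mult[symmetric] inner_commute[of _ w] dot_lmul_matrix)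
    finally show ?thesis by (simp add: quadratic_form_add quadratic_form_scaleR power2_eq_square mult_ac)
  qed
  ultimately show ?thesis
    by (simp add: shear_def \<kappa>_def shear_factor_def algebra_simps del: transpose_matrix_vector)
qed

section \<open>Normalization\<close>

text \<open>\<open>D\<close> is the change achieved up to higher weight, and it is the same for all
  \<open>F\<close>, since only the quadratic part matters at leading weight. This uniformity is what
  lets the changes add up when the maps are composed.\<close>

definition removable ::
    "('n + 'n \<Rightarrow> 'n + 'n \<Rightarrow> real) \<Rightarrow> nat \<Rightarrow> ((real ^ ('n::finite + 'n)) \<times> (real ^ 'm::finite) \<Rightarrow> real) \<Rightarrow> bool" where
  "removable s k D \<longleftrightarrow> weighted_order k D \<and>
     (\<exists>\<phi> \<psi>. canonical_pair \<phi> \<psi> \<and>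
       (\<forall>F. weighted_order 3 (\<lambda>z. F z - quadratic_form s (fst z)) \<longrightarrow>
          weighted_order (Suc k) (\<lambda>z. F (\<psi> (snd z) (fst z), snd z) - F z - D z)))"

lemma removable_zero: "removable s k (\<lambda>z. 0)"
  unfolding removable_def
  using canonical_pair_id by (auto intro!: weighted_order.zero exI[of _ "\<lambda>\<epsilon> x. x"])

lemma removable_add:
  assumes "removable s k D\<^sub>1" "removable s k D\<^sub>2" "3 \<le> k"
  shows "removable s k (\<lambda>z. D\<^sub>1 z + D\<^sub>2 z)"
proof -
  obtain \<phi>\<^sub>1 \<psi>\<^sub>1 where 1: "canonical_pair \<phi>\<^sub>1 \<psi>\<^sub>1"
    "\<And>F. weighted_order 3 (\<lambda>z. F z - quadratic_form s (fst z)) \<Longrightarrow>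
       weighted_order (Suc k) (\<lambda>z. F (\<psi>\<^sub>1 (snd z) (fst z), snd z) - F z - D\<^sub>1 z)"
    using assms(1) by (auto simp: removable_def)
  obtain \<phi>\<^sub>2 \<psi>\<^sub>2 where 2: "canonical_pair \<phi>\<^sub>2 \<psi>\<^sub>2"
    "\<And>F. weighted_order 3 (\<lambda>z. F z - quadratic_form s (fst z)) \<Longrightarrow>
       weighted_order (Suc k) (\<lambda>z. F (\<psi>\<^sub>2 (snd z) (fst z), snd z) - F z - D\<^sub>2 z)"
    using assms(2) by (auto simp: removable_def)
  have D: "weighted_order k D\<^sub>1" "weighted_order k D\<^sub>2" using assms by (auto simp: removable_def)
  have "weighted_order (Suc k)
      (\<lambda>z. F (\<psi>\<^sub>1 (snd z) (\<psi>\<^sub>2 (snd z) (fst z)), snd z) - F z - (D\<^sub>1 z + D\<^sub>2 z))"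
    if F: "weighted_order 3 (\<lambda>z. F z - quadratic_form s (fst z))" for F
  proof -
    define F' where "F' = (\<lambda>z. F (\<psi>\<^sub>1 (snd z) (fst z), snd z))"
    have F1: "weighted_order (Suc k) (\<lambda>z. F' z - F z - D\<^sub>1 z)"
      unfolding F'_def by (rule 1(2)[OF F])
    have "weighted_order 3 (\<lambda>z. (F' z - F z - D\<^sub>1 z) + (D\<^sub>1 z + (F z - quadratic_form s (fst z))))"
      using assms(3) by (intro weighted_order_add weighted_order_mono[OF F1] weighted_order_mono[OF D(1)] F) auto
    then have "weighted_order 3 (\<lambda>z. F' z - quadratic_form s (fst z))" by simp
    from weighted_order_add[OF 2(2)[OF this] F1] show ?thesis by (simp add: F'_def algebra_simps)
  qed
  with canonical_pair_compose[OF 1(1) 2(1)] weighted_order_add[OF D] show ?thesis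
    unfolding removable_def
    by (intro conjI exI[of _ "\<lambda>\<epsilon> x. \<phi>\<^sub>2 \<epsilon> (\<phi>\<^sub>1 \<epsilon> x)"] exI[of _ "\<lambda>\<epsilon> x. \<psi>\<^sub>1 \<epsilon> (\<psi>\<^sub>2 \<epsilon> x)"]) auto
qed

lemma removable_bracket:
  assumes "3 \<le> i + 2 * length v"
  shows "removable s (i + 2 * length v) (\<lambda>z. c * word_monomial v (snd z) *
     (real i * (w \<bullet> fst z) ^ (i - 1) * ((transpose (quadratic_field s) *v w) \<bullet> fst z)))"
    (is "removable s ?k ?D")
proof -
  have "weighted_order ?k ?D"
  proof (cases i)
    case 0
    then show ?thesis by (simp add: weighted_order.zero)
  next
    case (Suc j)
    have "weighted_order (2 * length v + (j * 1 + 1)) (\<lambda>z. c * word_monomial v (snd z) *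
       (real i * (w \<bullet> fst z) ^ j * ((transpose (quadratic_field s) *v w) \<bullet> fst z)))"
      using weighted_order_mult[OF weighted_order_monomial[of "2 * length v" "[]" v c]
          weighted_order_mult[OF weighted_order_cmult[OF weighted_order_power[OF weighted_order_inner]] weighted_order_inner]]
      by simp
    then show ?thesis using Suc by (simp add: add_ac)
  qed
  \<comment> \<open>\<open>shear_effect\<close> yields the bracket with a minus sign, so the
    substituted map carries \<open>- c\<close>.\<close>
  moreover have "weighted_order (Suc ?k) (\<lambda>z. F (shear (- c) v i w (snd z) (fst z), snd z) - F z - ?D z)"
    if "weighted_order 3 (\<lambda>z. F z - quadratic_form s (fst z))" for F
    using shear_effect[OF that assms, of "- c" w] by simp
  ultimately show ?thesis
    using canonical_pair_shear[OF assms, of "- c" w] unfolding removable_def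
    by (intro conjI exI[of _ "shear (- (- c)) v i w"] exI[of _ "shear (- c) v i w"] allI impI)
qed

definition normal_part ::
    "('n + 'n \<Rightarrow> 'n + 'n \<Rightarrow> real) \<Rightarrow> nat \<Rightarrow> ((real ^ ('n::finite + 'n)) \<times> (real ^ 'm::finite) \<Rightarrow> real) \<Rightarrow> bool" where
  "normal_part s d N \<longleftrightarrow> polynomial_degree_le d N \<and>
     (\<forall>t x \<epsilon>. N (mat_exp (t *\<^sub>R transpose (quadratic_field s)) *v x, \<epsilon>) = N (x, \<epsilon>))"

lemma normal_part_zero: "normal_part s d (\<lambda>z. 0)"
  by (simp add: normal_part_def polynomial_degree_le_zero)

lemma normal_part_add: "normal_part s d M \<Longrightarrow> normal_part s d N \<Longrightarrow> normal_part s d (\<lambda>z. M z + N z)"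
  by (simp add: normal_part_def polynomial_degree_le_add)

text \<open>The parameter monomial is constant for the flow in \<open>x\<close> and merely
  multiplies the homological equation for \<open>u\<close>. \<open>D\<close> is minus the bracket
  part, so what remains is invariant and has the same degrees in \<open>x\<close> and \<epsilon>.
  For \<open>u = []\<close> the brackets are 0 and the monomial passes into \<open>N\<close>
  unchanged.\<close>

lemma monomial_homological:
  fixes u :: "('n::finite + 'n) list" and v :: "'m::finite list"
  assumes "length u + length v \<le> d" "3 \<le> length u + 2 * length v"
  obtains N D where
    "\<And>z. c * (word_monomial u (fst z) * word_monomial v (snd z)) + D z = N z"
    "normal_part s d N" "weighted_order 3 N" "removable s (length u + 2 * length v) D"
proof -
  obtain cs ws where hom: "\<And>x. word_monomial u x = (\<Sum>v | length v = length u. cs v * word_monomial v x)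
       + (\<Sum>(a, w)\<leftarrow>ws. a * (real (length u) * (w \<bullet> x) ^ (length u - 1) * ((transpose (quadratic_field s) *v w) \<bullet> x)))"
    "\<And>x. (\<Sum>v | length v = length u. cs v * word_derivative v x (transpose (quadratic_field s) *v x)) = 0"
    by (rule homological_equation[of u "quadratic_field s"]) (rule that)
  define N\<^sub>0 where "N\<^sub>0 = (\<lambda>x. \<Sum>v | length v = length u. cs v * word_monomial v x)"
  define N where "N = (\<lambda>z. c * (N\<^sub>0 (fst z) * word_monomial v (snd z)))"
  define D where "D = (\<lambda>z. \<Sum>(a, w)\<leftarrow>ws. (- c * a) * word_monomial v (snd z) *
     (real (length u) * (w \<bullet> fst z) ^ (length u - 1) * ((transpose (quadratic_field s) *v w) \<bullet> fst z)))"
  have N: "N = (\<lambda>z. \<Sum>v' | length v' = length u. (c * cs v') * (word_monomial v' (fst z) * word_monomial v (snd z)))"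
    by (simp add: N_def N\<^sub>0_def sum_distrib_left sum_distrib_right mult_ac)
  have "(N\<^sub>0 has_derivative (\<lambda>y. \<Sum>v | length v = length u. cs v * word_derivative v x y)) (at x)" for x
    unfolding N\<^sub>0_def by (intro has_derivative_sum has_derivative_mult_right word_monomial_has_derivative)
  then have "N\<^sub>0 (mat_exp (t *\<^sub>R transpose (quadratic_field s)) *v x) = N\<^sub>0 x" for t x
    by (rule mat_exp_invariant) (rule hom(2))
  moreover have "polynomial_degree_le d N" unfolding N
    using assms(1) by (intro polynomial_degree_le_sum polynomial_degree_le_monomial) simp
  ultimately have "normal_part s d N"
    by (simp add: normal_part_def N_def del: transpose_matrix_vector)
  moreover have "weighted_order 3 N" unfolding N
    using assms(2) by (intro weighted_order_sum weighted_order_monomial) simp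
  moreover have "removable s (length u + 2 * length v) D"
    unfolding D_def
  proof (induction ws)
    case Nil
    then show ?case by (simp add: removable_zero)
  next
    case (Cons aw ws)
    obtain a w where "aw = (a, w)" by fastforce
    then show ?case
      using removable_add[OF removable_bracket[OF assms(2), of s "- c * a" w] Cons assms(2)]
      by (simp del: transpose_matrix_vector)
  qed
  moreover have "c * (word_monomial u (fst z) * word_monomial v (snd z)) + D z = N z" for z
  proof -
    have "D z = - (c * word_monomial v (snd z)) * (\<Sum>(a, w)\<leftarrow>ws. a * (real (length u) *
       (w \<bullet> fst z) ^ (length u - 1) * ((transpose (quadratic_field s) *v w) \<bullet> fst z)))"
      unfolding D_def by (induction ws) (auto simp: algebra_simps simp del: transpose_matrix_vector)
    then show ?thesis unfolding hom(1)[of "fst z"] N_def N\<^sub>0_def by (simp add: algebra_simps)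
  qed
  ultimately show ?thesis using that by blast
qed

text \<open>
  Terms of degree more than \<open>d\<close> may have weight \<open>k\<close>; they are put into \<open>J\<close> without being normalized.
\<close>

lemma weighted_order_decomposition:
  fixes f :: "(real ^ ('n::finite + 'n)) \<times> (real ^ 'm::finite) \<Rightarrow> real"
  assumes "weighted_order k f" "3 \<le> k"
  shows "\<exists>N J D r. (\<forall>z. f z + D z = N z + J z + r z) \<and> normal_part s d N \<and> weighted_order 3 N \<and>
    small_order (Suc d) J \<and> weighted_order 3 J \<and> removable s k D \<and> weighted_order (Suc k) r"
  using assms(1)
proof (induction rule: weighted_order.induct)
  case zero
  show ?case
    by (rule exI[of _ "\<lambda>z. 0"])+ (auto intro: normal_part_zero small_order_zero weighted_order.zero removable_zero)
next
  case (add_monomial f u v c)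
  then obtain N J D r where *: "\<And>z. f z + D z = N z + J z + r z" "normal_part s d N" "weighted_order 3 N"
    "small_order (Suc d) J" "weighted_order 3 J" "removable s k D" "weighted_order (Suc k) r"
    by blast
  define m where "m = (\<lambda>z. c * (word_monomial u (fst z) * word_monomial v (snd z)))"
  \<comment> \<open>A monomial heavier than \<open>k\<close> joins the remainder for a later step;
    one of weight exactly \<open>k\<close> is normalized now if its degree permits.\<close>
  consider "Suc k \<le> length u + 2 * length v"
    | "k = length u + 2 * length v" "length u + length v \<le> d"
    | "Suc d \<le> length u + length v"
    using add_monomial.hyps(2) by linarith
  then show ?case
  proof cases
    case 1
    then have "weighted_order (Suc k) m" unfolding m_def by (rule weighted_order_monomial)
    from weighted_order_add[OF *(7) this] * show ?thesis
      by (intro exI[of _ N] exI[of _ J] exI[of _ D] exI[of _ "\<lambda>z. r z + m z"]) (auto simp: m_def algebra_simps)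
  next
    case 2
    with assms(2) obtain M E where M: "\<And>z. m z + E z = M z" "normal_part s d M" "weighted_order 3 M" "removable s k E"
      using monomial_homological[of u v d c s] unfolding m_def by metis
    have "f z + m z + (D z + E z) = (N z + M z) + J z + r z" for z
      using *(1)[of z] M(1)[of z] by simp
    then show ?thesis
      using normal_part_add[OF *(2) M(2)] weighted_order_add[OF *(3) M(3)] removable_add[OF *(6) M(4) assms(2)] *(4,5,7)
      unfolding m_def
      by (intro exI[of _ "\<lambda>z. N z + M z"] exI[of _ J] exI[of _ "\<lambda>z. D z + E z"] exI[of _ r]) auto
  next
    case 3
    then have "small_order (Suc d) m" unfolding m_def by (rule small_order_monomial)
    moreover have "weighted_order 3 m" unfolding m_def
      using add_monomial.hyps(2) assms(2) by (intro weighted_order_monomial) simp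
    ultimately show ?thesis
      using small_order_add[OF *(4), of m] weighted_order_add[OF *(5), of m] *
      by (intro exI[of _ N] exI[of _ "\<lambda>z. J z + m z"] exI[of _ D] exI[of _ r]) (auto simp: m_def algebra_simps)
  qed
qed

text \<open>Each step composes one more canonical map. The property in \<open>removable\<close> is
  applied to the whole transformed Hamiltonian, so the disturbance of the earlier \<open>N\<close>
  and \<open>J\<close> is absorbed by the new remainder of weight \<open>Suc k\<close>. Keeping
  \<open>N\<close> and \<open>J\<close> at weight at least 3 makes that property applicable at the
  next step.\<close>

lemma polynomial_normal_form:
  fixes F :: "(real ^ ('n::finite + 'n)) \<times> (real ^ 'm::finite) \<Rightarrow> real"
  assumes "weighted_order 3 (\<lambda>z. F z - quadratic_form s (fst z))" "3 \<le> k"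
  shows "\<exists>\<phi> \<psi> N J r. canonical_pair \<phi> \<psi> \<and>
    (\<forall>z. F (\<psi> (snd z) (fst z), snd z) = quadratic_form s (fst z) + N z + J z + r z) \<and>
    normal_part s d N \<and> weighted_order 3 N \<and> small_order (Suc d) J \<and> weighted_order 3 J \<and> weighted_order k r"
  using assms(2)
proof (induction k rule: dec_induct)
  case base
  show ?case
    by (rule exI[of _ "\<lambda>\<epsilon> x. x"], rule exI[of _ "\<lambda>\<epsilon> x. x"], rule exI[of _ "\<lambda>z. 0"],
        rule exI[of _ "\<lambda>z. 0"], rule exI[of _ "\<lambda>z. F z - quadratic_form s (fst z)"])
      (auto intro: canonical_pair_id normal_part_zero small_order_zero weighted_order.zero assms(1))
next
  case (step k)
  then obtain \<phi> \<psi> N J r where *: "canonical_pair \<phi> \<psi>"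
    "\<And>z. F (\<psi> (snd z) (fst z), snd z) = quadratic_form s (fst z) + N z + J z + r z"
    "normal_part s d N" "weighted_order 3 N" "small_order (Suc d) J" "weighted_order 3 J" "weighted_order k r"
    by blast
  obtain N' J' D r' where r: "\<And>z. r z + D z = N' z + J' z + r' z" "normal_part s d N'" "weighted_order 3 N'"
    "small_order (Suc d) J'" "weighted_order 3 J'" "removable s k D" "weighted_order (Suc k) r'"
    using weighted_order_decomposition[OF *(7) step.hyps(1)] by blast
  obtain \<phi>' \<psi>' where 2: "canonical_pair \<phi>' \<psi>'"
    "\<And>F. weighted_order 3 (\<lambda>z. F z - quadratic_form s (fst z)) \<Longrightarrow>
       weighted_order (Suc k) (\<lambda>z. F (\<psi>' (snd z) (fst z), snd z) - F z - D z)"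
    using r(6) by (auto simp: removable_def)
  define F' where "F' = (\<lambda>z. F (\<psi> (snd z) (fst z), snd z))"
  have "weighted_order 3 (\<lambda>z. N z + J z + r z)"
    using step.hyps(1) by (intro weighted_order_add *(4,6) weighted_order_mono[OF *(7)])
  then have "weighted_order 3 (\<lambda>z. F' z - quadratic_form s (fst z))" by (simp add: F'_def *(2) add.assoc)
  then have "weighted_order (Suc k) (\<lambda>z. F' (\<psi>' (snd z) (fst z), snd z) - F' z - D z)"
    by (rule 2(2))
  from weighted_order_add[OF this r(7)]
  have "weighted_order (Suc k) (\<lambda>z. F' (\<psi>' (snd z) (fst z), snd z) - F' z - D z + r' z)" .
  moreover have "F (\<psi> (snd z) (\<psi>' (snd z) (fst z)), snd z)
      = quadratic_form s (fst z) + (N z + N' z) + (J z + J' z) + (F' (\<psi>' (snd z) (fst z), snd z) - F' z - D z + r' z)" for z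
    using r(1)[of z] *(2)[of z] by (simp add: F'_def)
  ultimately show ?case
    using canonical_pair_compose[OF *(1) 2(1)] normal_part_add[OF *(3) r(2)] weighted_order_add[OF *(4) r(3)]
      small_order_add[OF *(5) r(4)] weighted_order_add[OF *(6) r(5)]
    by (intro exI[of _ "\<lambda>\<epsilon> x. \<phi>' \<epsilon> (\<phi> \<epsilon> x)"] exI[of _ "\<lambda>\<epsilon> x. \<psi> \<epsilon> (\<psi>' \<epsilon> x)"] exI[of _ "\<lambda>z. N z + N' z"]
        exI[of _ "\<lambda>z. J z + J' z"] exI[of _ "\<lambda>z. F' (\<psi>' (snd z) (fst z), snd z) - F' z - D z + r' z"]) auto
qed

section \<open>Taylor polynomials of the Hamiltonian\<close>

text \<open>Along a ray both expansions are polynomials in \<open>t\<close> with error of order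
  \<open>t ^ n\<close>, so their coefficients agree. Taylor terms can thus be read off from an
  estimate instead of being computed by differentiation.\<close>

lemma Taylor_coefficients_unique:
  fixes f :: "'a::euclidean_space \<Rightarrow> real"
  assumes "open S" "0 \<in> S" "Ck_on n S f" "j < n"
    and "\<And>j t z. p j (t *\<^sub>R z) = t ^ j * p j z"
    and "0 < \<delta>" "\<And>z. norm z \<le> \<delta> \<Longrightarrow> \<bar>f z - (\<Sum>j<n. p j z)\<bar> \<le> C * norm z ^ n"
  shows "iter_deriv j f z 0 / fact j = p j z"
proof (cases "z = 0")
  case False
  have "0 < n" using assms(4) by simp
  then obtain C' \<delta>' where T: "0 < \<delta>'"
    "\<And>z. norm z \<le> \<delta>' \<Longrightarrow> \<bar>f z - (\<Sum>j<n. iter_deriv j f z 0 / fact j)\<bar> \<le> C' * norm z ^ n"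
    using Taylor_iter_deriv[OF assms(1-3)] by blast
  have "iter_deriv j f z 0 / fact j - p j z = 0"
  \<comment> \<open>The range of \<open>t\<close> keeps \<open>t *\<^sub>R z\<close> inside both
    balls; it involves division by \<open>norm z\<close>, which is why \<open>z = 0\<close> is a
    separate case.\<close>
  proof (rule coeffs_zero_of_small[where n=n and \<delta>="min \<delta> \<delta>' / norm z" and C="(C + C') * norm z ^ n"])
    show "0 < min \<delta> \<delta>' / norm z" using False assms(6) T(1) by simp
    fix t :: real assume t: "0 < t" "t < min \<delta> \<delta>' / norm z"
    then have le: "norm (t *\<^sub>R z) \<le> \<delta>" "norm (t *\<^sub>R z) \<le> \<delta>'" using False by (simp_all add: field_simps)
    have "(\<Sum>j<n. (iter_deriv j f z 0 / fact j - p j z) * t ^ j)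
      = (\<Sum>j<n. iter_deriv j f (t *\<^sub>R z) 0 / fact j) - (\<Sum>j<n. p j (t *\<^sub>R z))"
      unfolding sum_subtractf[symmetric] iter_deriv_scaleR assms(5) by (simp add: algebra_simps)
    then have "\<bar>\<Sum>j<n. (iter_deriv j f z 0 / fact j - p j z) * t ^ j\<bar>
      \<le> C * norm (t *\<^sub>R z) ^ n + C' * norm (t *\<^sub>R z) ^ n"
      using assms(7)[OF le(1)] T(2)[OF le(2)] by linarith
    also have "\<dots> = (C + C') * norm z ^ n * t ^ n"
      using t(1) by (simp add: power_mult_distrib algebra_simps)
    finally show "\<bar>\<Sum>j<n. (iter_deriv j f z 0 / fact j - p j z) * t ^ j\<bar> \<le> (C + C') * norm z ^ n * t ^ n" .
  qed (rule assms(4))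
  then show ?thesis by simp
next
  case True
  have zero: "a j 0 = 0" if "\<And>j t z. a j (t *\<^sub>R z) = t ^ j * a j z" "j \<noteq> 0" for a :: "nat \<Rightarrow> 'a \<Rightarrow> real" and j
    using that(1)[of j 0 0] that(2) by (simp add: power_0_left)
  show ?thesis
  proof (cases "j = 0")
    case j: True
    have "\<bar>f 0 - (\<Sum>j<n. p j 0)\<bar> \<le> C * norm (0::'a) ^ n" by (rule assms(7)) (use assms(6) in simp)
    then have "f 0 = (\<Sum>j<n. p j 0)" using assms(4) by (simp add: power_0_left)
    also have "\<dots> = p 0 0"
      using assms(4) zero[of p, OF assms(5)] by (subst sum.remove[of _ 0]) (auto intro!: sum.neutral)
    finally show ?thesis using True j by simp
  next
    case False
    then show ?thesis
      using True zero[of p j, OF assms(5)] zero[of "\<lambda>j z. iter_deriv j f z 0" j, OF iter_deriv_scaleR] by simp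
  qed
qed

lemma sum_Basis_vec: "(\<Sum>b\<in>Basis. g b) = (\<Sum>i\<in>UNIV. g (axis i 1))" for g :: "real ^ 'k::finite \<Rightarrow> real"
proof -
  have Basis: "(Basis :: (real ^ 'k) set) = range (\<lambda>i. axis i 1)" by (auto simp: Basis_vec_def)
  have "inj (\<lambda>i. axis i 1 :: real ^ 'k)" by (simp add: inj_on_def axis_eq_axis)
  then show ?thesis unfolding Basis by (simp add: sum.reindex)
qed

lemma quadratic_part_eq_iter_deriv: "quadratic_part f x = iter_deriv 2 f x 0 / 2"
proof -
  have "(\<Sum>j\<in>UNIV. \<Sum>k\<in>UNIV. partial_derivative j (partial_derivative k f) 0 * x $ j * x $ k)
    = (\<Sum>k\<in>UNIV. \<Sum>j\<in>UNIV. partial_derivative j (partial_derivative k f) 0 * x $ j * x $ k)"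
    by (rule sum.swap)
  then show ?thesis
    by (simp add: quadratic_part_def numeral_2_eq_2 sum_Basis_vec inner_axis partial_derivative_def[abs_def]
        sum_distrib_left mult_ac)
qed

text \<open>A cubic error bound determines the quadratic part, which spares differentiating the
  transformed Hamiltonian twice.\<close>

lemma quadratic_part_unique:
  assumes "open S" "0 \<in> S" "Ck_on 3 S f"
    and "0 < \<delta>" "\<And>x. norm x \<le> \<delta> \<Longrightarrow> \<bar>f x - quadratic_form s x\<bar> \<le> C * norm x ^ 3"
  shows "quadratic_part f = quadratic_form s"
proof
  fix x
  have "iter_deriv 2 f x 0 / fact 2 = (if (2::nat) = 2 then quadratic_form s x else 0)"
    using assms
    by (intro Taylor_coefficients_unique[where n=3 and p="\<lambda>j x. if j = 2 then quadratic_form s x else 0"])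
      (auto simp: quadratic_form_scaleR numeral_3_eq_3)
  then show "quadratic_part f x = quadratic_form s x" by (simp add: quadratic_part_eq_iter_deriv)
qed

section \<open>Weights of the Taylor terms\<close>

lemma weighted_order_inner_snd: "weighted_order 2 (\<lambda>z. snd z \<bullet> w)" for w :: "real ^ 'm::finite"
  unfolding inner_vec_def inner_real_def
  using weighted_order_cmult[OF weighted_order_snd_nth] by (intro weighted_order_sum) (simp add: mult.commute)

lemma weighted_order_inner_fst: "weighted_order 1 (\<lambda>z. fst z \<bullet> w)" for w :: "real ^ 'k::finite"
  using weighted_order_inner[of w] by (simp add: inner_commute)

lemma weighted_order_inner_prod:
  "weighted_order 1 (\<lambda>z. z \<bullet> b)" for b :: "(real ^ 'k::finite) \<times> (real ^ 'm::finite)"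
  unfolding inner_prod_def
  by (intro weighted_order_add weighted_order_inner_fst weighted_order_mono[OF weighted_order_inner_snd]) simp

lemma weighted_order_iter_deriv:
  "weighted_order j (\<lambda>z :: (real ^ 'k::finite) \<times> (real ^ 'm::finite). iter_deriv j f z y)"
proof (induction j arbitrary: f)
  case 0
  then show ?case by (simp add: weighted_order_const)
next
  case (Suc j)
  show ?case unfolding iter_deriv.simps
    using weighted_order_mult[OF weighted_order_inner_prod Suc] by (intro weighted_order_sum) simp
qed

lemma quadratic_form_sum_inner:
  "quadratic_form (\<lambda>j k. \<Sum>(b, b')\<in>I. c b b' * (p b $ j * p b' $ k)) x = (\<Sum>(b, b')\<in>I. c b b' * ((x \<bullet> p b) * (x \<bullet> p b')))"
proof (induction I rule: infinite_finite_induct)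
  case (insert bb I)
  obtain b b' where "bb = (b, b')" by (cases bb)
  moreover have "c b b' * ((x \<bullet> p b) * (x \<bullet> p b')) = quadratic_form (\<lambda>j k. c b b' * (p b $ j * p b' $ k)) x"
    by (simp add: quadratic_form_def inner_vec_def sum_product sum_distrib_left mult_ac)
  ultimately show ?case using insert
    by (simp add: quadratic_form_def algebra_simps sum.distrib)
qed (simp_all add: quadratic_form_def)

text \<open>After splitting \<open>z\<close> into its \<open>x\<close> and \<epsilon> parts, every
  product that is not purely in \<open>x\<close> has a factor in \<epsilon> of weight 2 and another
  factor of weight at least 1.\<close>

lemma iter_deriv_2_quadratic:
  fixes h :: "(real ^ 'k::finite) \<times> (real ^ 'm::finite) \<Rightarrow> real"
  obtains s where "weighted_order 3 (\<lambda>z. iter_deriv 2 h z 0 / 2 - quadratic_form s (fst z))"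
proof -
  define c where "c = (\<lambda>b b'. frechet_derivative (\<lambda>y. frechet_derivative h (at y) b) (at 0) b' / 2)"
  define I where "I = (Basis \<times> Basis :: (((real ^ 'k) \<times> (real ^ 'm)) \<times> ((real ^ 'k) \<times> (real ^ 'm))) set)"
  define s where "s = (\<lambda>j k. \<Sum>(b, b')\<in>I. c b b' * (fst b $ j * fst b' $ k))"
  have prod: "(z \<bullet> b) * (z \<bullet> b') = (fst z \<bullet> fst b) * (fst z \<bullet> fst b') + ((snd z \<bullet> snd b) * (z \<bullet> b')
      + (fst z \<bullet> fst b) * (snd z \<bullet> snd b'))" for z b b' :: "(real ^ 'k) \<times> (real ^ 'm)"
    by (simp add: inner_prod_def algebra_simps)
  have "iter_deriv 2 h z 0 / 2 - quadratic_form s (fst z) = (\<Sum>(b, b')\<in>I. c b b' * ((snd z \<bullet> snd b) * (z \<bullet> b')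
      + (fst z \<bullet> fst b) * (snd z \<bullet> snd b')))" for z
  proof -
    have "iter_deriv 2 h z 0 / 2 = (\<Sum>(b, b')\<in>I. c b b' * ((z \<bullet> b) * (z \<bullet> b')))"
      by (simp add: numeral_2_eq_2 I_def c_def sum.cartesian_product[symmetric] sum_distrib_left sum_divide_distrib mult_ac)
    also have "\<dots> = (\<Sum>(b, b')\<in>I. c b b' * ((fst z \<bullet> fst b) * (fst z \<bullet> fst b')))
      + (\<Sum>(b, b')\<in>I. c b b' * ((snd z \<bullet> snd b) * (z \<bullet> b') + (fst z \<bullet> fst b) * (snd z \<bullet> snd b')))"
      unfolding prod by (simp add: distrib_left sum.distrib case_prod_unfold)
    finally show ?thesis unfolding s_def quadratic_form_sum_inner by linarith
  qed
  moreover have "weighted_order 3 (\<lambda>z. c b b' * ((snd z \<bullet> snd b) * (z \<bullet> b') + (fst z \<bullet> fst b) * (snd z \<bullet> snd b')))" for b b'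
    using weighted_order_mult[OF weighted_order_inner_snd weighted_order_inner_prod, of "snd b" b']
      weighted_order_mult[OF weighted_order_inner_fst weighted_order_inner_snd, of "fst b" "snd b'"]
    by (intro weighted_order_cmult weighted_order_add) (simp_all add: numeral_3_eq_3)
  ultimately show ?thesis
    using that[of s] by (simp add: case_prod_unfold weighted_order_sum)
qed

text \<open>At \<epsilon> = 0 only monomials with empty \<open>v\<close> survive, and for them
  weight and degree coincide. Hence terms of weight 3 leave the quadratic part at \<epsilon> = 0
  alone.\<close>

lemma weighted_order_imp_small_order_fst:
  assumes "weighted_order k f"
  shows "small_order k (\<lambda>x. f (x, 0))"
  using assms
proof (induction rule: weighted_order.induct)
  case zero
  then show ?case by (rule small_order_zero)
next
  case (add_monomial f u v c)
  have "small_order k (\<lambda>x. c * (word_monomial u x * word_monomial v 0))"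
  proof (cases v)
    case Nil
    have "\<bar>c * word_monomial u x\<bar> \<le> \<bar>c\<bar> * norm x ^ k" if "norm x \<le> 1" for x
    proof -
      have "norm x ^ length u \<le> norm x ^ k"
        using add_monomial.hyps(2) Nil that by (intro power_decreasing) auto
      then show ?thesis
        using abs_word_monomial_le[of u x] by (simp add: abs_mult mult_left_mono)
    qed
    then show ?thesis using Nil by (auto simp: small_order_def)
  next
    case Cons
    then show ?thesis by (simp add: small_order_zero)
  qed
  with add_monomial.IH show ?case using small_order_add by fastforce
qed

section \<open>Transfer to the smooth Hamiltonian\<close>

lemma polynomial_function_linear_bound:
  fixes g :: "'a::euclidean_space \<Rightarrow> 'b::euclidean_space"
  assumes "polynomial_function g" "g 0 = 0"
  obtains B \<delta> where "0 < \<delta>" "0 < B" "\<And>z. norm z \<le> \<delta> \<Longrightarrow> norm (g z) \<le> B * norm z"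
proof -
  obtain g' where der: "\<And>z. (g has_derivative g' z) (at z)" "\<And>v. polynomial_function (\<lambda>z. g' z v)"
    by (rule polynomial_function_derivative[OF assms(1)]) (rule that)
  note g' = der(1)[of 0]
  from has_derivative_at_alt[THEN iffD1, OF g', THEN conjunct2, rule_format, OF zero_less_one]
  obtain d where d: "0 < d" "\<And>z. norm z < d \<Longrightarrow> norm (g z - g' 0 z) \<le> norm z"
    using assms(2) by auto
  obtain K where K: "0 < K" "\<And>z. norm (g' 0 z) \<le> norm z * K"
    using bounded_linear.pos_bounded[OF has_derivative_bounded_linear[OF g']] by blast
  have "norm (g z) \<le> (K + 1) * norm z" if "norm z \<le> d / 2" for z
  proof -
    have "norm (g z) \<le> norm (g' 0 z) + norm (g z - g' 0 z)" by (rule norm_triangle_sub)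
    also have "\<dots> \<le> norm z * K + norm z" using that d(1) by (intro add_mono K d(2)) auto
    finally show ?thesis by (simp add: algebra_simps)
  qed
  then show ?thesis using that[of "d / 2" "K + 1"] d(1) K(1) by simp
qed

text \<open>The quadratic bound removes the Taylor terms of order 0 and 1; from order 3 on, the
  weight is at least the degree, so only the pure \<open>x\<close> part of order 2 has weight below
  3.\<close>

lemma Taylor_polynomial_split:
  fixes h :: "(real ^ 'k::finite) \<times> (real ^ 'm::finite) \<Rightarrow> real"
  assumes "open S" "0 \<in> S" "smooth_on S h" "3 \<le> n"
    and "0 < \<delta>" "\<forall>z. norm z \<le> \<delta> \<longrightarrow> \<bar>h z\<bar> \<le> C * norm z ^ 2"
  shows "\<exists>s T C' \<delta>'. weighted_order 3 (\<lambda>z. T z - quadratic_form s (fst z)) \<and>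
    0 < \<delta>' \<and> (\<forall>z. norm z \<le> \<delta>' \<longrightarrow> \<bar>h z - T z\<bar> \<le> C' * norm z ^ n)"
proof -
  have Ck: "Ck_on k S h" for k using assms(3) by (simp add: smooth_on_def)
  have low: "iter_deriv j h z 0 = 0" if "j < 2" for j z
    using Taylor_coefficients_unique[where n=2 and p="\<lambda>j z. 0" and \<delta>=\<delta> and C=C, OF assms(1,2) Ck that _ assms(5)] assms(6)
    by simp
  obtain s where s: "weighted_order 3 (\<lambda>z. iter_deriv 2 h z 0 / 2 - quadratic_form s (fst z))"
    by (rule iter_deriv_2_quadratic)
  define T where "T = (\<lambda>z. \<Sum>j<n. iter_deriv j h z 0 / fact j)"
  have "T z = iter_deriv 2 h z 0 / 2 + (\<Sum>j\<in>{3..<n}. iter_deriv j h z 0 / fact j)" for z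
  proof -
    have "{..<n} = {0, 1, 2} \<union> {3..<n}" using assms(4) by auto
    then have "T z = (\<Sum>j\<in>{0, 1, 2}. iter_deriv j h z 0 / fact j) + (\<Sum>j\<in>{3..<n}. iter_deriv j h z 0 / fact j)"
      unfolding T_def by (simp only:) (rule sum.union_disjoint; auto)
    then show ?thesis using low[of 0 z] low[of 1 z] by (simp del: iter_deriv.simps)
  qed
  moreover have "weighted_order 3 (\<lambda>z. (1 / fact j) * iter_deriv j h z 0)" if "j \<in> {3..<n}" for j
    using that by (intro weighted_order_cmult weighted_order_mono[OF weighted_order_iter_deriv]) simp
  ultimately have "weighted_order 3 (\<lambda>z. T z - quadratic_form s (fst z))"
    using weighted_order_add[OF s weighted_order_sum[of "{3..<n}" 3 "\<lambda>j z. iter_deriv j h z 0 / fact j"]]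
    by (simp add: algebra_simps)
  moreover have "0 < n" using assms(4) by simp
  with Taylor_iter_deriv[OF assms(1,2) Ck[of n]] obtain C' \<delta>' where
    "0 < \<delta>'" "\<And>z. norm z \<le> \<delta>' \<Longrightarrow> \<bar>h z - (\<Sum>j<n. iter_deriv j h z 0 / fact j)\<bar> \<le> C' * norm z ^ n"
    by blast
  ultimately show ?thesis
    by (intro exI[of _ s] exI[of _ T] exI[of _ C'] exI[of _ \<delta>']) (simp add: T_def)
qed

lemma local_normal_form:
  fixes h :: "(real ^ ('n::finite + 'n)) \<times> (real ^ 'm::finite) \<Rightarrow> real"
  assumes "open S" "0 \<in> S" "smooth_on S h" "n\<^sub>0 \<ge> 1"
    and "0 < \<delta>" "\<forall>z. norm z \<le> \<delta> \<longrightarrow> \<bar>h z\<bar> \<le> C * norm z ^ 2"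
  shows "\<exists>\<phi> \<psi>. canonical_pair \<phi> \<psi> \<and> elphick_normal_form n\<^sub>0 (\<lambda>\<epsilon> x. h (\<psi> \<epsilon> x, \<epsilon>))"
proof -
  have n3: "3 \<le> n\<^sub>0 + 2" using assms(4) by simp
  obtain s T C\<^sub>1 \<delta>\<^sub>1 where T: "weighted_order 3 (\<lambda>z. T z - quadratic_form s (fst z))"
    "0 < \<delta>\<^sub>1" "\<And>z. norm z \<le> \<delta>\<^sub>1 \<Longrightarrow> \<bar>h z - T z\<bar> \<le> C\<^sub>1 * norm z ^ (n\<^sub>0 + 2)"
    using Taylor_polynomial_split[OF assms(1-3) n3 assms(5,6)] by blast
  \<comment> \<open>\<open>2 * n\<^sub>0 + 3\<close> is the least weight that forces degree
    \<open>n\<^sub>0 + 2\<close>, the order demanded of the remainder.\<close>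
  obtain \<phi> \<psi> N J r where nf: "canonical_pair \<phi> \<psi>"
    "\<And>z. T (\<psi> (snd z) (fst z), snd z) = quadratic_form s (fst z) + N z + J z + r z"
    "normal_part s (n\<^sub>0 + 1) N" "weighted_order 3 N" "small_order (Suc (n\<^sub>0 + 1)) J"
    "weighted_order (2 * n\<^sub>0 + 3) r"
    using polynomial_normal_form[OF T(1), of "2 * n\<^sub>0 + 3" "n\<^sub>0 + 1"] by auto
  define g where "g = (\<lambda>z. (\<psi> (snd z) (fst z), snd z))"
  have g: "polynomial_function g" unfolding g_def
    using nf(1) by (intro polynomial_function_Pair polynomial_function_bounded_linear[OF bounded_linear_snd])
      (simp add: canonical_pair_def)
  have "\<psi> 0 0 = 0" using nf(1) unfolding canonical_pair_def by metis
  then have g0: "g 0 = 0" by (simp add: g_def zero_prod_def)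
  obtain B \<delta>\<^sub>2 where B: "0 < \<delta>\<^sub>2" "0 < B" "\<And>z. norm z \<le> \<delta>\<^sub>2 \<Longrightarrow> norm (g z) \<le> B * norm z"
    using polynomial_function_linear_bound[OF g g0] by metis
  have "small_order (n\<^sub>0 + 2) (\<lambda>z. J z + r z)"
    using small_order_add[OF nf(5) weighted_order_imp_small_order[OF nf(6)]] by simp
  then obtain C\<^sub>2 where C2: "\<And>z. norm z \<le> 1 \<Longrightarrow> \<bar>J z + r z\<bar> \<le> C\<^sub>2 * norm z ^ (n\<^sub>0 + 2)"
    by (auto simp: small_order_def)
  \<comment> \<open>With \<open>R\<close> defined as the difference, the decomposition holds
    identically and only the order of \<open>R\<close> has to be estimated.\<close>
  define R where "R = (\<lambda>z. h (g z) - quadratic_form s (fst z) - N z)"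
  \<comment> \<open>The three radii serve the estimate of \<open>J + r\<close>, the linear bound on
    \<open>g\<close>, and the requirement that \<open>g z\<close> stay where \<open>T\<close>
    approximates \<open>h\<close>.\<close>
  define \<delta>\<^sub>3 where "\<delta>\<^sub>3 = min 1 (min \<delta>\<^sub>2 (\<delta>\<^sub>1 / B))"
  define C\<^sub>3 where "C\<^sub>3 = \<bar>C\<^sub>1\<bar> * B ^ (n\<^sub>0 + 2) + C\<^sub>2"
  have \<delta>3: "0 < \<delta>\<^sub>3" using B T(2) by (simp add: \<delta>\<^sub>3_def)
  have R: "\<bar>R z\<bar> \<le> C\<^sub>3 * norm z ^ (n\<^sub>0 + 2)" if "norm z \<le> \<delta>\<^sub>3" for z
  proof -
    have z: "norm z \<le> 1" "norm z \<le> \<delta>\<^sub>2" "norm z * B \<le> \<delta>\<^sub>1"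
      using that B(2) by (auto simp: \<delta>\<^sub>3_def pos_le_divide_eq)
    have "R z = (h (g z) - T (g z)) + (J z + r z)"
      using nf(2)[of z] by (simp add: R_def g_def)
    moreover have "\<bar>h (g z) - T (g z)\<bar> \<le> C\<^sub>1 * norm (g z) ^ (n\<^sub>0 + 2)"
      using B(3)[OF z(2)] z(3) by (intro T(3)) (simp add: mult.commute)
    moreover have "C\<^sub>1 * norm (g z) ^ (n\<^sub>0 + 2) \<le> \<bar>C\<^sub>1\<bar> * (B * norm z) ^ (n\<^sub>0 + 2)"
      using B(3)[OF z(2)] by (intro mult_mono power_mono) auto
    ultimately have "\<bar>R z\<bar> \<le> \<bar>C\<^sub>1\<bar> * (B * norm z) ^ (n\<^sub>0 + 2) + C\<^sub>2 * norm z ^ (n\<^sub>0 + 2)"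
      using C2[OF z(1)] by linarith
    then show ?thesis by (simp add: C\<^sub>3_def power_mult_distrib algebra_simps)
  qed
  \<comment> \<open>The normal form takes its quadratic part from the transformed Hamiltonian, so
    this part must be recognized as the form \<open>s\<close> that governed the
    normalization.\<close>
  define f where "f = (\<lambda>x. h (\<psi> 0 x, 0))"
  have "quadratic_part f = quadratic_form s"
  proof -
    have f: "f x = h (g (x, 0))" for x by (simp add: f_def g_def)
    have "polynomial_function (\<lambda>x :: real ^ ('n + 'n). (x, 0 :: real ^ 'm))"
      by (intro polynomial_function_Pair polynomial_function_id polynomial_function_const)
    from polynomial_function_compose[OF this g] have p: "polynomial_function (\<lambda>x. g (x, 0))"
      by (simp add: o_def)
    define S' where "S' = (\<lambda>x. g (x, 0)) -` S"
    have S': "open S'" unfolding S'_def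
      by (intro open_vimage assms(1) continuous_on_polymonial_function p)
    moreover have "0 \<in> S'" using g0 assms(2) by (simp add: S'_def zero_prod_def)
    moreover have "Ck_on 3 S' f" unfolding f
      using assms(3) by (intro Ck_on_compose_polynomial[OF S' assms(1) p]) (auto simp: S'_def smooth_on_def)
    moreover obtain C\<^sub>4 where C4: "\<And>x. norm x \<le> 1 \<Longrightarrow> \<bar>N (x, 0)\<bar> \<le> C\<^sub>4 * norm x ^ 3"
      using weighted_order_imp_small_order_fst[OF nf(4)] by (auto simp: small_order_def)
    moreover have "\<bar>f x - quadratic_form s x\<bar> \<le> (C\<^sub>4 + \<bar>C\<^sub>3\<bar>) * norm x ^ 3" if "norm x \<le> \<delta>\<^sub>3" for x
    proof -
      have x: "norm x \<le> 1" using that by (simp add: \<delta>\<^sub>3_def)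
      have "norm (x, 0 :: real ^ 'm) = norm x" by (simp add: norm_Pair)
      then have "\<bar>R (x, 0)\<bar> \<le> C\<^sub>3 * norm x ^ (n\<^sub>0 + 2)" using R[of "(x, 0)"] that by simp
      also have "\<dots> \<le> \<bar>C\<^sub>3\<bar> * norm x ^ 3"
        using x assms(4) by (intro mult_mono power_decreasing) auto
      finally show ?thesis using C4[OF x] by (simp add: R_def f algebra_simps)
    qed
    ultimately show ?thesis using \<delta>3 by (intro quadratic_part_unique[of S' f \<delta>\<^sub>3 s "C\<^sub>4 + \<bar>C\<^sub>3\<bar>"]) auto
  qed
  then have Q: "quadratic_part (\<lambda>x. h (\<psi> 0 x, 0)) = quadratic_form s" by (simp add: f_def)
  have "elphick_normal_form n\<^sub>0 (\<lambda>\<epsilon> x. h (\<psi> \<epsilon> x, \<epsilon>))"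
    unfolding elphick_normal_form_def Q hamiltonian_vector_field_quadratic_form Let_def
  proof (rule exI[of _ "\<lambda>x \<epsilon>. N (x, \<epsilon>)"], rule exI[of _ "\<lambda>x \<epsilon>. R (x, \<epsilon>)"], intro conjI)
    show "polynomial_degree_le (n\<^sub>0 + 1) (\<lambda>(x, \<epsilon>). N (x, \<epsilon>))"
      using nf(3) by (simp add: normal_part_def)
    show "\<forall>t x \<epsilon>. N (mat_exp (t *\<^sub>R transpose (quadratic_field s)) *v x, \<epsilon>) = N (x, \<epsilon>)"
      using nf(3) by (simp add: normal_part_def)
    have "\<forall>\<^sub>F z in nhds 0. norm (R z) \<le> C\<^sub>3 * norm (norm z ^ (n\<^sub>0 + 2))"
      unfolding eventually_nhds_metric using \<delta>3 R by (intro exI[of _ \<delta>\<^sub>3]) (auto simp: dist_norm)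
    then show "(\<lambda>(x, \<epsilon>). R (x, \<epsilon>)) \<in> O[nhds 0](\<lambda>(x, \<epsilon>). norm (x, \<epsilon>) ^ (n\<^sub>0 + 2))"
      by (intro bigoI[where c=C\<^sub>3]) (simp add: case_prod_unfold)
    show "\<forall>\<^sub>F (x, \<epsilon>) in nhds 0. h (\<psi> \<epsilon> x, \<epsilon>) = quadratic_form s x + N (x, \<epsilon>) + R (x, \<epsilon>)"
      by (simp add: R_def g_def case_prod_unfold)
  qed
  with nf(1) show ?thesis by (intro exI conjI)
qed

text \<open>\<open>\<phi>\<close> involves neither q_0 nor p_0, so the derivative and the symplectic
  form split into two blocks and p_0 needs no correction. \<open>V\<close> is the exact image of
  \<open>W\<close>, because the maps are mutually inverse on the whole space.\<close>

lemma change_of_variables_of_canonical_pair: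
  fixes W :: "((real ^ 'm::finite) \<times> 'n::finite phase) set"
  assumes "canonical_pair \<phi> \<psi>" "open W"
  defines "\<Phi> \<equiv> \<lambda>\<epsilon> z. (\<phi> \<epsilon> (fst z), snd z)" and "\<Psi> \<equiv> \<lambda>\<epsilon> z. (\<psi> \<epsilon> (fst z), snd z)"
  defines "V \<equiv> {(\<epsilon>, Z). (\<epsilon>, \<Psi> \<epsilon> Z) \<in> W}"
  shows "change_of_variables W V \<Phi> \<Psi>" "near_identity \<Phi>" "canonical_on W \<Phi>"
proof -
  have lift: "polynomial_function (\<lambda>(\<epsilon>, z :: 'n phase). (f \<epsilon> (fst z), snd z))"
    if "polynomial_function (\<lambda>z. f (snd z) (fst z))" for f :: "real ^ 'm \<Rightarrow> real ^ ('n + 'n) \<Rightarrow> real ^ ('n + 'n)"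
  proof -
    have "polynomial_function (\<lambda>y :: (real ^ 'm) \<times> 'n phase. (fst (snd y), fst y))"
      by (intro polynomial_function_bounded_linear bounded_linear_intros)
    from polynomial_function_compose[OF this that]
    have "polynomial_function (\<lambda>y :: (real ^ 'm) \<times> 'n phase. f (fst y) (fst (snd y)))" by (simp add: o_def)
    then show ?thesis unfolding case_prod_unfold
      by (intro polynomial_function_Pair) (auto intro!: polynomial_function_bounded_linear bounded_linear_intros)
  qed
  have \<Phi>: "polynomial_function (\<lambda>(\<epsilon>, z). \<Phi> \<epsilon> z)" and \<Psi>: "polynomial_function (\<lambda>(\<epsilon>, z). \<Psi> \<epsilon> z)"
    using assms(1) lift[of \<phi>] lift[of \<psi>] by (simp_all add: canonical_pair_def \<Phi>_def \<Psi>_def)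
  have inv: "\<Psi> \<epsilon> (\<Phi> \<epsilon> z) = z" "\<Phi> \<epsilon> (\<Psi> \<epsilon> z) = z" for \<epsilon> z
    using assms(1) by (simp_all add: canonical_pair_def \<Phi>_def \<Psi>_def)
  have "polynomial_function (\<lambda>(\<epsilon>, z). (\<epsilon>, \<Psi> \<epsilon> z))"
    using polynomial_function_Pair[OF polynomial_function_bounded_linear[OF bounded_linear_fst] \<Psi>]
    by (simp add: case_prod_unfold)
  then have "open ((\<lambda>(\<epsilon>, z). (\<epsilon>, \<Psi> \<epsilon> z)) -` W)"
    by (intro open_vimage assms(2) continuous_on_polymonial_function)
  moreover have "V = (\<lambda>(\<epsilon>, z). (\<epsilon>, \<Psi> \<epsilon> z)) -` W" by (auto simp: V_def)
  ultimately have V: "open V" by simp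
  show "change_of_variables W V \<Phi> \<Psi>"
    unfolding change_of_variables_def
    using assms(2) V smooth_on_polynomial_function[OF assms(2) \<Phi>] smooth_on_polynomial_function[OF V \<Psi>]
    by (auto simp: inv V_def)
  have deriv: "(\<Phi> \<epsilon> has_derivative (\<lambda>v. (D (fst v), snd v))) (at z)"
    if "(\<phi> \<epsilon> has_derivative D) (at (fst z))" for \<epsilon> z D
    unfolding \<Phi>_def
    by (intro has_derivative_Pair has_derivative_compose[of fst fst z UNIV "\<phi> \<epsilon>" D] that
        has_derivative_fst has_derivative_snd has_derivative_ident)
  show "near_identity \<Phi>"
    unfolding near_identity_def
    using assms(1) deriv[of 0 "\<lambda>v. v" 0] by (simp add: canonical_pair_def \<Phi>_def zero_prod_def)
  show "canonical_on W \<Phi>"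
    unfolding canonical_on_def
  proof (clarify)
    fix \<epsilon> and x :: "real ^ ('n + 'n)" and q p :: real and v w :: "'n phase"
    obtain D where D: "(\<phi> \<epsilon> has_derivative D) (at x)" "\<And>a b. D a \<bullet> \<J> (D b) = a \<bullet> \<J> b"
      using assms(1) unfolding canonical_pair_def by blast
    obtain a q\<^sub>1 p\<^sub>1 b q\<^sub>2 p\<^sub>2 where vw: "v = (a, q\<^sub>1, p\<^sub>1)" "w = (b, q\<^sub>2, p\<^sub>2)"
      by (metis surj_pair)
    have "frechet_derivative (\<Phi> \<epsilon>) (at (x, q, p)) = (\<lambda>v. (D (fst v), snd v))"
      using deriv[of \<epsilon> D "(x, q, p)"] D(1) by (simp add: frechet_derivative_at[symmetric])
    then show "symplectic_form (frechet_derivative (\<Phi> \<epsilon>) (at (x, q, p)) v) (frechet_derivative (\<Phi> \<epsilon>) (at (x, q, p)) w)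
       = symplectic_form v w"
      unfolding vw by (simp only: fst_conv snd_conv symplectic_form_eq D(2))
  qed
qed

theorem theorem4p4:
  fixes H :: "real ^ 'm::finite \<Rightarrow> 'n::finite phase \<Rightarrow> real"
    and W :: "((real ^ 'm) \<times> 'n phase) set"
    and n\<^sub>0 :: nat
  assumes "n\<^sub>0 \<ge> 2"
    and "open W" and "(0, 0) \<in> W"
    and "smooth_on W (\<lambda>(\<epsilon>, z). H \<epsilon> z)"
    and "(\<lambda>(\<epsilon>, x, q\<^sub>0, p\<^sub>0). H \<epsilon> (x, q\<^sub>0, p\<^sub>0))
           \<in> O[nhds 0](\<lambda>(\<epsilon>, x, q\<^sub>0, p\<^sub>0). norm (\<epsilon>, q\<^sub>0, x) * norm (q\<^sub>0, x))"
    and "p0_cyclic_on W H"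
  shows "\<exists>U V \<Phi> \<Psi>.
           (0, 0) \<in> U \<and> U \<subseteq> W \<and>
           change_of_variables U V \<Phi> \<Psi> \<and> near_identity \<Phi> \<and> canonical_on U \<Phi> \<and>
           (\<forall>(\<epsilon>, z)\<in>U. fst (snd (\<Phi> \<epsilon> z)) = fst (snd z)) \<and>
           p0_cyclic_on V (\<lambda>\<epsilon> Z. H \<epsilon> (\<Psi> \<epsilon> Z)) \<and>
           elphick_normal_form n\<^sub>0 (\<lambda>\<epsilon> x. H \<epsilon> (\<Psi> \<epsilon> (x, 0, 0)))"
proof -
  \<comment> \<open>The slice q_0 = p_0 = 0, with the order of variables and parameters exchanged to
    match the polynomial part of the argument.\<close>
  define p where "p = (\<lambda>(x, \<epsilon>). (\<epsilon>, (x, 0, 0)) :: (real ^ 'm) \<times> 'n phase)"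
  define h where "h = (\<lambda>(x, \<epsilon>). H \<epsilon> (x, 0, 0))"
  define S where "S = p -` W"
  have p: "polynomial_function p"
    unfolding p_def case_prod_unfold
    by (intro polynomial_function_bounded_linear bounded_linear_intros)
  have S: "open S" unfolding S_def
    by (intro open_vimage assms(2) continuous_on_polymonial_function p)
  have S0: "0 \<in> S" using assms(3) by (simp add: S_def p_def zero_prod_def)
  have h: "h = (\<lambda>z. (\<lambda>(\<epsilon>, z). H \<epsilon> z) (p z))" by (auto simp: h_def p_def)
  have smooth: "smooth_on S h"
    unfolding smooth_on_def h
    by (intro allI Ck_on_compose_polynomial[OF S assms(2) p])
      (use assms(4) in \<open>auto simp: S_def smooth_on_def\<close>)
  obtain C where "\<forall>\<^sub>F y in nhds 0. norm ((\<lambda>(\<epsilon>, x, q\<^sub>0, p\<^sub>0). H \<epsilon> (x, q\<^sub>0, p\<^sub>0)) y)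
      \<le> C * norm ((\<lambda>(\<epsilon>, x, q\<^sub>0, p\<^sub>0). norm (\<epsilon>, q\<^sub>0, x) * norm (q\<^sub>0, x)) y)" and C: "0 < C"
    using landau_o.bigE[OF assms(5)] by blast
  then obtain d where d: "0 < d" "\<And>y. norm y < d \<Longrightarrow> norm ((\<lambda>(\<epsilon>, x, q\<^sub>0, p\<^sub>0). H \<epsilon> (x, q\<^sub>0, p\<^sub>0)) y)
      \<le> C * norm ((\<lambda>(\<epsilon>, x, q\<^sub>0, p\<^sub>0). norm (\<epsilon>, q\<^sub>0, x) * norm (q\<^sub>0, x)) y)"
    unfolding eventually_nhds_metric by (auto simp: dist_norm)
  \<comment> \<open>On the slice the hypothesis gives \<open>C * (norm z * norm x)\<close>, weakened
    here to the quadratic bound that eliminates the Taylor terms of order 0 and 1. Halving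
    \<open>d\<close> passes to a closed ball.\<close>
  have bound: "\<forall>z. norm z \<le> d / 2 \<longrightarrow> \<bar>h z\<bar> \<le> C * norm z ^ 2"
  proof (intro allI impI)
    fix z :: "(real ^ ('n + 'n)) \<times> (real ^ 'm)" assume that: "norm z \<le> d / 2"
    obtain x \<epsilon> where z: "z = (x, \<epsilon>)" by fastforce
    have n: "norm (p z) = norm z" "norm (\<epsilon>, 0 :: real, x) = norm z" "norm (0 :: real, x) = norm x"
      by (simp_all add: z p_def norm_Pair add.commute)
    have "norm (p z) < d" using that d(1) n(1) by simp
    from d(2)[OF this] have "\<bar>h z\<bar> \<le> C * (norm z * norm x)" by (simp add: h_def p_def z n[unfolded z])
    also have "\<dots> \<le> C * (norm z * norm z)"
      using C norm_fst_le[of x \<epsilon>] by (intro mult_left_mono) (auto simp: z)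
    finally show "\<bar>h z\<bar> \<le> C * norm z ^ 2" by (simp add: power2_eq_square)
  qed
  have "0 < d / 2" "1 \<le> n\<^sub>0" using assms(1) d(1) by simp_all
  then obtain \<phi> \<psi> where nf: "canonical_pair \<phi> \<psi>" "elphick_normal_form n\<^sub>0 (\<lambda>\<epsilon> x. h (\<psi> \<epsilon> x, \<epsilon>))"
    using local_normal_form[OF S S0 smooth _ _ bound] by blast
  define \<Phi> where "\<Phi> = (\<lambda>\<epsilon> (z :: 'n phase). (\<phi> \<epsilon> (fst z), snd z))"
  define \<Psi> where "\<Psi> = (\<lambda>\<epsilon> (z :: 'n phase). (\<psi> \<epsilon> (fst z), snd z))"
  define V where "V = {(\<epsilon>, Z :: 'n phase). (\<epsilon>, \<psi> \<epsilon> (fst Z), snd Z) \<in> W}"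
  note change = change_of_variables_of_canonical_pair[OF nf(1) assms(2), folded \<Phi>_def \<Psi>_def, folded V_def]
  \<comment> \<open>\<open>\<Psi>\<close> changes neither q_0 nor p_0 and acts on \<open>x\<close>
    independently of them, so points of \<open>V\<close> differing only in p_0 go to points of
    \<open>W\<close> differing only in p_0.\<close>
  have "p0_cyclic_on V (\<lambda>\<epsilon> Z. H \<epsilon> (\<Psi> \<epsilon> Z))"
    unfolding p0_cyclic_on_def
  proof (intro allI impI)
    fix \<epsilon> x and q\<^sub>0 p\<^sub>0 p\<^sub>0' :: real
    assume "(\<epsilon>, x, q\<^sub>0, p\<^sub>0) \<in> V" "(\<epsilon>, x, q\<^sub>0, p\<^sub>0') \<in> V"
    then show "H \<epsilon> (\<Psi> \<epsilon> (x, q\<^sub>0, p\<^sub>0)) = H \<epsilon> (\<Psi> \<epsilon> (x, q\<^sub>0, p\<^sub>0'))"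
      using assms(6)[unfolded p0_cyclic_on_def, rule_format, of \<epsilon> "\<psi> \<epsilon> x" q\<^sub>0 p\<^sub>0 p\<^sub>0']
      by (simp add: V_def \<Psi>_def)
  qed
  moreover have "elphick_normal_form n\<^sub>0 (\<lambda>\<epsilon> x. H \<epsilon> (\<Psi> \<epsilon> (x, 0, 0)))"
    using nf(2) by (simp add: h_def \<Psi>_def)
  moreover have "\<forall>(\<epsilon>, z)\<in>W. fst (snd (\<Phi> \<epsilon> z)) = fst (snd z)" by (simp add: \<Phi>_def)
  \<comment> \<open>The maps are defined everywhere, so \<open>U\<close> can be all of
    \<open>W\<close>.\<close>
  ultimately show ?thesis
    using change assms(3)
    by - (rule exI[of _ W], rule exI[of _ V], rule exI[of _ \<Phi>], rule exI[of _ \<Psi>], intro conjI subset_refl)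
qed

end
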